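(* Let $0\le\alpha<\pi$ and $\nu>0$. For real $\mu$ let $C_\mu(x)=(\cos\alpha)J_\mu(x)-(\sin\alpha)Y_\mu(x)$, $x>0$, let $c_{\mu,k}$ be the $k$th positive zero of $C_\mu$, and let $\Delta_\nu(x)=C_\nu^2(x)-C_{\nu-1}(x)C_{\nu+1}(x)$ for $x>0$. Then the relative maxima of the function $x\mapsto\Delta_\nu(x)$ on $(0,\infty)$ occur at the zeros of $C_{\nu-1}$ and the relative minima occur at the zeros of $C_{\nu+1}$. The corresponding relative maximum values $M_{\nu,k}$ and relative minimum values $m_{\nu,k}$ are $$M_{\nu,k}=\Delta_\nu(c_{\nu-1,k})=C_\nu^2(c_{\nu-1,k})>0,\qquad m_{\nu,k}=\Delta_\nu(c_{\nu+1,k})=C_\nu^2(c_{\nu+1,k})>0,$$ and for all $x\ge c_{\nu-1,1}$, $$C_\nu^2(x)-C_{\nu-1}(x)C_{\nu+1}(x)>0.$$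
   Context: $J_\mu$ and $Y_\mu$ are the Bessel functions of the first and second kind of real order $\mu$, considered on $(0,\infty)$. For a fixed $\alpha\in[0,\pi)$, $C_\mu(x)=(\cos\alpha)J_\mu(x)-(\sin\alpha)Y_\mu(x)$ is called the general Bessel function (cylinder function) of order $\mu$; the same $\alpha$ is used for $C_{\nu-1}$, $C_\nu$, $C_{\nu+1}$. The positive zeros $c_{\mu,1}<c_{\mu,2}<\cdots$ of $C_\mu$ are listed in increasing order (they depend on $\alpha$). *)

theory Defs
  imports "HOL-Analysis.Analysis"
begin

(* Bessel functions of real order, meant for x > 0 only. rGamma is the entire function 1/Gamma,
   so terms whose Gamma factor has a pole (negative integer order) vanish. *)

definition bessel_J :: "real \<Rightarrow> real \<Rightarrow> real" where
  "bessel_J \<mu> x =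
     (\<Sum>m. (-1) ^ m * rGamma (real m + \<mu> + 1) / fact m * (x / 2) powr (2 * real m + \<mu>))"

definition bessel_Y_nonint :: "real \<Rightarrow> real \<Rightarrow> real" where
  "bessel_Y_nonint \<mu> x = (bessel_J \<mu> x * cos (\<mu> * pi) - bessel_J (-\<mu>) x) / sin (\<mu> * pi)"

definition bessel_Y :: "real \<Rightarrow> real \<Rightarrow> real" where
  "bessel_Y \<mu> x =
     (if \<mu> \<in> \<int> then Lim (at \<mu>) (\<lambda>t. bessel_Y_nonint t x) else bessel_Y_nonint \<mu> x)"

definition cylinder_C :: "real \<Rightarrow> real \<Rightarrow> real \<Rightarrow> real" where
  "cylinder_C \<alpha> \<mu> x = cos \<alpha> * bessel_J \<mu> x - sin \<alpha> * bessel_Y \<mu> x"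

(* The k-th element, counted from k = 1, of a set of positive reals listed in increasing order.
   Since infinite sets have card 0, for k > 0 the condition also says that only finitely
   many elements lie below x. *)
definition kth_element :: "real set \<Rightarrow> nat \<Rightarrow> real" where
  "kth_element S k = (THE x. x \<in> S \<and> card {y \<in> S. y \<le> x} = k)"

definition cylinder_zeros :: "real \<Rightarrow> real \<Rightarrow> real set" where
  "cylinder_zeros \<alpha> \<mu> = {x. 0 < x \<and> cylinder_C \<alpha> \<mu> x = 0}"

definition cylinder_zero :: "real \<Rightarrow> real \<Rightarrow> nat \<Rightarrow> real" where
  "cylinder_zero \<alpha> \<mu> k = kth_element (cylinder_zeros \<alpha> \<mu>) k"

definition turanian :: "real \<Rightarrow> real \<Rightarrow> real \<Rightarrow> real" where
  "turanian \<alpha> \<nu> x =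
     (cylinder_C \<alpha> \<nu> x)\<^sup>2 - cylinder_C \<alpha> (\<nu> - 1) x * cylinder_C \<alpha> (\<nu> + 1) x"

definition rel_max_points :: "(real \<Rightarrow> real) \<Rightarrow> real set" where
  "rel_max_points f = {x. 0 < x \<and> (\<forall>\<^sub>F y in at x within {0<..}. f y \<le> f x)}"

definition rel_min_points :: "(real \<Rightarrow> real) \<Rightarrow> real set" where
  "rel_min_points f = {x. 0 < x \<and> (\<forall>\<^sub>F y in at x within {0<..}. f x \<le> f y)}"

definition rel_max_value :: "(real \<Rightarrow> real) \<Rightarrow> nat \<Rightarrow> real" where
  "rel_max_value f k = f (kth_element (rel_max_points f) k)"

definition rel_min_value :: "(real \<Rightarrow> real) \<Rightarrow> nat \<Rightarrow> real" where
  "rel_min_value f k = f (kth_element (rel_min_points f) k)"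

end

theory Submission
  imports Defs
begin

text \<open>
  The recurrences for cylinder functions give \<open>\<Delta>' = (2 / x) C\<^bsub>\<nu>-1\<^esub> C\<^bsub>\<nu>+1\<^esub>\<close>. At a zero of \<open>C\<^bsub>\<nu>-1\<^esub>\<close> the
  product \<open>C\<^bsub>\<nu>-1\<^esub> C\<^bsub>\<nu>+1\<^esub>\<close> has slope \<open>- (2 \<nu> / x) C\<^bsub>\<nu>\<^esub>\<^sup>2\<close>, at a zero of \<open>C\<^bsub>\<nu>+1\<^esub>\<close> it has the opposite slope,
  and the Wronskian of \<open>J\<close> and \<open>Y\<close> excludes common zeros with \<open>C\<^bsub>\<nu>\<^esub>\<close>; this determines the extrema. Between
  two zeros of \<open>C\<^bsub>\<nu>-1\<^esub>\<close> the minimum of \<open>\<Delta>\<close> is attained at an endpoint or at a critical point, where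
  \<open>\<Delta> = C\<^bsub>\<nu>\<^esub>\<^sup>2 > 0\<close>, and zeros of \<open>C\<^bsub>\<nu>-1\<^esub>\<close> are unbounded by Sturm comparison.

  At integer order the limit defining \<open>Y\<^bsub>n\<^esub>\<close> is a quotient of derivatives with respect to the order:
  \<open>\<pi> Y\<^bsub>n\<^esub> = K\<^bsub>n\<^esub> + (-1)\<^sup>n K\<^bsub>-n\<^esub>\<close> with \<open>K\<^bsub>\<mu>\<^esub> = \<partial>J\<^bsub>\<mu>\<^esub> / \<partial>\<mu>\<close>. The recurrences and the Wronskian for \<open>Y\<^bsub>n\<^esub>\<close> follow
  by differentiating those for \<open>J\<^bsub>\<mu>\<^esub>\<close> in \<open>\<mu>\<close>.
\<close>

section \<open>The reciprocal Gamma function and its derivative: bounds on right half-lines\<close>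

abbreviation rGamma' :: "real \<Rightarrow> real" where
  "rGamma' \<equiv> deriv rGamma"

lemma DERIV_rGamma: "(rGamma has_real_derivative rGamma' z) (at z)"
  by (metis DERIV_imp_deriv has_field_derivative_rGamma)

lemma DERIV_rGamma_add: "((\<lambda>z. rGamma (z + c)) has_real_derivative rGamma' (z + c)) (at z)"
  using DERIV_rGamma[of "z + c"] by (simp add: DERIV_shift)

lemma rGamma'_shift: "rGamma' z = rGamma (z + 1) + z * rGamma' (z + 1)"
proof -
  have "((\<lambda>z::real. z * rGamma (z + 1)) has_real_derivative rGamma (z + 1) + z * rGamma' (z + 1)) (at z)"
    using DERIV_mult[OF DERIV_ident DERIV_rGamma_add[of 1 z]] by (simp add: ac_simps)
  then show ?thesis
    using DERIV_rGamma[of z] by (simp add: rGamma_plus1 DERIV_unique)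
qed

text \<open>The recurrence \<open>rGamma z = z * rGamma (z + 1)\<close> propagates bounds upwards from \<open>[1, 3]\<close>
  because it divides by \<open>z \<ge> 2\<close>.\<close>

lemma rGamma_bounded_ge_1:
  "\<exists>K. \<forall>z\<ge>1. \<bar>rGamma (z::real)\<bar> \<le> K \<and> \<bar>rGamma' z\<bar> \<le> K"
proof -
  have nonpos: "{1..3} \<inter> \<int>\<^sub>\<le>\<^sub>0 = ({}::real set)"
    by (auto elim!: nonpos_Ints_cases)
  have "continuous_on {1..3::real} rGamma"
    by (intro continuous_intros)
  moreover have "continuous_on {1..3} rGamma'"
  proof -
    \<comment> \<open>The interval avoids the poles of \<open>Digamma\<close>, so continuity of the
      derivative can be read off from this formula.\<close>
    have "rGamma' z = - rGamma z * Digamma z" if "z \<in> {1..3}" for z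
      using that nonpos by (intro DERIV_imp_deriv has_field_derivative_rGamma_no_nonpos_int) blast
    moreover have "continuous_on {1..3::real} (\<lambda>z. - rGamma z * Digamma z)"
      using nonpos by (intro continuous_intros continuous_on_Polygamma)
    ultimately show ?thesis
      by (metis (mono_tags, lifting) continuous_on_cong)
  qed
  ultimately have "bounded (rGamma ` {1..3::real})" "bounded (rGamma' ` {1..3})"
    by (blast intro: compact_imp_bounded compact_continuous_image)+
  then obtain B B' where "\<forall>z\<in>{1..3}. \<bar>rGamma (z::real)\<bar> \<le> B" "\<forall>z\<in>{1..3}. \<bar>rGamma' z\<bar> \<le> B'"
    unfolding bounded_iff by (auto simp del: One_nat_def)
  then have base: "\<bar>rGamma z\<bar> \<le> max B B'" "\<bar>rGamma' z\<bar> \<le> max B B'" if "1 \<le> z" "z \<le> 3" for z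
    using that by (auto simp: le_max_iff_disj)
  have "\<bar>rGamma z\<bar> \<le> max B B' \<and> \<bar>rGamma' z\<bar> \<le> max B B'" if "1 \<le> z" "z \<le> 3 + real n" for n z
    using that
  proof (induction n arbitrary: z)
    case 0
    then show ?case
      using base by simp
  next
    case (Suc n)
    show ?case
    proof (cases "z \<le> 3")
      case True
      then show ?thesis
        using base Suc.prems by simp
    next
      case False
      define w where "w = z - 1"
      then have w: "w \<ge> 2" "z = w + 1" "\<bar>rGamma w\<bar> \<le> max B B'" "\<bar>rGamma' w\<bar> \<le> max B B'"
        using False Suc.prems Suc.IH[of w] by auto
      have "w * \<bar>rGamma z\<bar> = \<bar>rGamma w\<bar>"
        using rGamma_plus1[of w] w by (metis abs_mult abs_of_nonneg order_trans zero_le_numeral)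
      moreover have "w * \<bar>rGamma z\<bar> \<ge> 2 * \<bar>rGamma z\<bar>"
        using w by (intro mult_right_mono) auto
      \<comment> \<open>The gained factor 2 absorbs the summand \<open>rGamma z\<close> in the
        recurrence for \<open>rGamma'\<close>: with \<open>M = max B B'\<close> the sum is at most
        \<open>M + M / 2 \<le> 2 * M\<close>.\<close>
      ultimately have 1: "2 * \<bar>rGamma z\<bar> \<le> max B B'"
        using w by linarith
      have "w * \<bar>rGamma' z\<bar> = \<bar>rGamma' w - rGamma z\<bar>"
        using rGamma'_shift[of w] w by (simp add: abs_mult)
      moreover have "w * \<bar>rGamma' z\<bar> \<ge> 2 * \<bar>rGamma' z\<bar>"
        using w by (intro mult_right_mono) auto
      ultimately have "2 * \<bar>rGamma' z\<bar> \<le> 2 * max B B'"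
        using w 1 by linarith
      with 1 show ?thesis
        by linarith
    qed
  qed
  then have "\<bar>rGamma z\<bar> \<le> max B B' \<and> \<bar>rGamma' z\<bar> \<le> max B B'" if "1 \<le> z" for z
    using that real_arch_simple[of z] by (meson add_increasing order.refl order_trans zero_le_numeral)
  then show ?thesis
    by blast
qed

text \<open>Moving the left end down by one through \<open>rGamma z = z * rGamma (z + 1)\<close>
  costs a factor \<open>\<bar>z\<bar> \<le> n + 1\<close>, and for the derivative one more summand.
  This makes negative orders accessible.\<close>

lemma rGamma_bounded_ge:
  "\<exists>K. \<forall>z\<ge>1 - real n. \<bar>rGamma (z::real)\<bar> \<le> K \<and> \<bar>rGamma' z\<bar> \<le> K"
proof (induction n)
  case 0
  then show ?case
    using rGamma_bounded_ge_1 by simp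
next
  case (Suc n)
  then obtain K where K: "\<And>z. z \<ge> 1 - real n \<Longrightarrow> \<bar>rGamma z\<bar> \<le> K \<and> \<bar>rGamma' z\<bar> \<le> K"
    by blast
  have "K \<ge> 0"
    using K[of 1] by fastforce
  have "\<bar>rGamma z\<bar> \<le> K + real (Suc n) * K \<and> \<bar>rGamma' z\<bar> \<le> K + real (Suc n) * K"
    if z: "z \<ge> 1 - real (Suc n)" for z
  proof (cases "z \<ge> 1 - real n")
    case True
    then show ?thesis
      using K[of z] \<open>K \<ge> 0\<close> by (smt (verit) mult_nonneg_nonneg of_nat_0_le_iff)
  next
    case False
    then have "\<bar>z\<bar> \<le> real (Suc n)"
      using z by auto
    moreover have "\<bar>rGamma (z + 1)\<bar> \<le> K" "\<bar>rGamma' (z + 1)\<bar> \<le> K"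
      using K[of "z + 1"] z by auto
    ultimately have "\<bar>z * rGamma (z + 1)\<bar> \<le> real (Suc n) * K" "\<bar>z * rGamma' (z + 1)\<bar> \<le> real (Suc n) * K"
      unfolding abs_mult by (auto intro!: mult_mono simp del: of_nat_Suc)
    then show ?thesis
      using rGamma_plus1[of z] rGamma'_shift[of z] \<open>\<bar>rGamma (z + 1)\<bar> \<le> K\<close> \<open>K \<ge> 0\<close>
      by linarith
  qed
  then show ?case
    by blast
qed

lemma rGamma_reflection_real: "rGamma z * rGamma (1 - z) = sin (pi * z) / pi" for z :: real
proof -
  have "complex_of_real (rGamma z * rGamma (1 - z)) = of_real (sin (pi * z) / pi)"
    using rGamma_reflection_complex[of "of_real z"]
    by (simp flip: rGamma_complex_of_real sin_of_real)
  then show ?thesis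
    using of_real_eq_iff by blast
qed

subsection \<open>Order and argument derivatives of Bessel series\<close>

text \<open>The exponential generating function of \<open>b\<close> at \<open>- z\<close>. For
  bounded \<open>b\<close> the exponential series dominates it, and differentiation shifts
  \<open>b\<close> and changes the sign.\<close>

definition alt_egf :: "(nat \<Rightarrow> real) \<Rightarrow> real \<Rightarrow> real" where
  "alt_egf b z = (\<Sum>m. (-1) ^ m * b m / fact m * z ^ m)"

lemma alt_egf_term_le:
  assumes "\<bar>b m\<bar> \<le> (K::real)"
  shows "\<bar>(-1) ^ m * b m / fact m * z ^ m\<bar> \<le> K * (\<bar>z\<bar> ^ m /\<^sub>R fact m)"
proof -
  have "\<bar>(-1) ^ m * b m / fact m * z ^ m\<bar> = \<bar>b m\<bar> * (\<bar>z\<bar> ^ m /\<^sub>R fact m)"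
    by (simp add: abs_mult power_abs field_simps)
  also have "\<dots> \<le> K * (\<bar>z\<bar> ^ m /\<^sub>R fact m)"
    using assms by (intro mult_right_mono) auto
  finally show ?thesis .
qed

lemma summable_alt_egf_bound: "summable (\<lambda>m. K * (\<bar>z\<bar> ^ m /\<^sub>R fact m))" for z :: real
  using summable_exp_generic[of "\<bar>z\<bar>"] by (rule summable_mult)

lemma summable_alt_egf:
  fixes K :: real
  assumes "\<And>m. \<bar>b m\<bar> \<le> K"
  shows "summable (\<lambda>m. (-1) ^ m * b m / fact m * z ^ m)"
  using assms
  by (intro summable_comparison_test'[OF summable_alt_egf_bound[of K z]])
     (auto simp only: real_norm_def intro!: alt_egf_term_le)

lemma alt_egf_0: "alt_egf b 0 = b 0"
  using powser_zero[of "\<lambda>m. (-1) ^ m * b m / fact m"] by (simp add: alt_egf_def)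

lemma DERIV_alt_egf:
  assumes "\<And>m. \<bar>b m\<bar> \<le> K"
  shows "(alt_egf b has_real_derivative - alt_egf (\<lambda>m. b (Suc m)) z) (at z)"
proof -
  have "diffs (\<lambda>m. (-1) ^ m * b m / fact m) = (\<lambda>m. - ((-1) ^ m * b (Suc m) / fact m))"
    by (rule ext) (simp add: diffs_def del: of_nat_Suc)
  then have "(alt_egf b has_real_derivative (\<Sum>m. - ((-1) ^ m * b (Suc m) / fact m) * z ^ m)) (at z)"
    using termdiffs_strong_converges_everywhere[OF summable_alt_egf[of b], OF assms]
    by (simp add: alt_egf_def[abs_def])
  moreover have "(\<Sum>m. - ((-1) ^ m * b (Suc m) / fact m) * z ^ m) = - alt_egf (\<lambda>m. b (Suc m)) z"
    unfolding alt_egf_def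
    using suminf_minus[OF summable_alt_egf[of "\<lambda>m. b (Suc m)" K z]] assms by simp
  ultimately show ?thesis
    by simp
qed

text \<open>The Bessel-Clifford function at \<open>- z\<close>: what remains of \<open>J\<close>
  once the power \<open>(x / 2) powr \<mu>\<close> is split off. It is smooth at 0, where Wronskians
  can be evaluated.\<close>

definition bessel_E :: "real \<Rightarrow> real \<Rightarrow> real" where
  "bessel_E \<mu> = alt_egf (\<lambda>m. rGamma (real m + \<mu> + 1))"

definition order_deriv_E :: "real \<Rightarrow> real \<Rightarrow> real" where
  "order_deriv_E \<mu> = alt_egf (\<lambda>m. rGamma' (real m + \<mu> + 1))"

text \<open>Uniformity in \<mu> over a compact interval is what termwise differentiation in the
  order requires.\<close>

lemma rGamma_coeffs_bounded:
  "\<exists>K. \<forall>m. \<forall>\<mu>\<in>{-R..R}. \<bar>rGamma (real m + \<mu> + 1)\<bar> \<le> K \<and> \<bar>rGamma' (real m + \<mu> + 1)\<bar> \<le> K"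
proof -
  obtain n where "R \<le> real n"
    using real_arch_simple by blast
  then have "real m + \<mu> + 1 \<ge> 1 - real n" if "\<mu> \<in> {-R..R}" for m \<mu>
    using that by auto
  then show ?thesis
    using rGamma_bounded_ge[of n] by meson
qed

lemma rGamma_coeffs_bounded_at:
  "\<exists>K. \<forall>m. \<bar>rGamma (real m + \<mu> + 1)\<bar> \<le> K \<and> \<bar>rGamma' (real m + \<mu> + 1)\<bar> \<le> K"
proof -
  have "\<mu> \<in> {- \<bar>\<mu>\<bar>..\<bar>\<mu>\<bar>}"
    by auto
  then show ?thesis
    using rGamma_coeffs_bounded[of "\<bar>\<mu>\<bar>"] by blast
qed

lemma DERIV_bessel_E: "(bessel_E \<mu> has_real_derivative - bessel_E (\<mu> + 1) z) (at z)"
proof -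
  obtain K where "\<And>m. \<bar>rGamma (real m + \<mu> + 1)\<bar> \<le> K"
    using rGamma_coeffs_bounded_at[of \<mu>] by blast
  from DERIV_alt_egf[of "\<lambda>m. rGamma (real m + \<mu> + 1)", OF this] show ?thesis
    unfolding bessel_E_def by (simp add: algebra_simps)
qed

lemma DERIV_order_deriv_E: "(order_deriv_E \<mu> has_real_derivative - order_deriv_E (\<mu> + 1) z) (at z)"
proof -
  obtain K where "\<And>m. \<bar>rGamma' (real m + \<mu> + 1)\<bar> \<le> K"
    using rGamma_coeffs_bounded_at[of \<mu>] by blast
  from DERIV_alt_egf[of "\<lambda>m. rGamma' (real m + \<mu> + 1)", OF this] show ?thesis
    unfolding order_deriv_E_def by (simp add: algebra_simps)
qed

text \<open>Coefficientwise,
  \<open>rGamma (m + \<mu>) = (m + \<mu>) * rGamma (m + \<mu> + 1)\<close>. The summand \<mu> yields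
  the first term; the factor \<open>m\<close> kills the term at 0 and cancels into
  \<open>fact m\<close>, which shifts the index and yields the second.\<close>

lemma bessel_E_rec: "bessel_E (\<mu> - 1) z = \<mu> * bessel_E \<mu> z - z * bessel_E (\<mu> + 1) z"
proof -
  let ?r = "\<lambda>\<mu> m. rGamma (real m + \<mu> + 1)" and ?t = "\<lambda>b m. (-1) ^ m * b m / fact m * z ^ m"
  obtain K where K: "\<And>m. \<bar>?r \<mu> m\<bar> \<le> K"
    using rGamma_coeffs_bounded_at[of \<mu>] by blast
  obtain K1 where K1: "\<And>m. \<bar>?r (\<mu> + 1) m\<bar> \<le> K1"
    using rGamma_coeffs_bounded_at[of "\<mu> + 1"] by blast
  define f where "f m = ?t (?r (\<mu> - 1)) m - \<mu> * ?t (?r \<mu>) m" for m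
  have f: "f m = real m * ((-1) ^ m * ?r \<mu> m / fact m * z ^ m)" for m
  proof -
    have "real m + (\<mu> - 1) + 1 = real m + \<mu>"
      by simp
    then have "?r (\<mu> - 1) m = (real m + \<mu>) * ?r \<mu> m"
      by (simp only: rGamma_plus1)
    then show ?thesis
      unfolding f_def by (simp only: divide_inverse) (simp only: algebra_simps)
  qed
  have "f (Suc m) = - z * ?t (?r (\<mu> + 1)) m" for m
  proof -
    have "?r \<mu> (Suc m) = ?r (\<mu> + 1) m"
      by (simp add: ac_simps)
    then show ?thesis
      unfolding f by (simp add: divide_simps del: of_nat_Suc)
  qed
  then have "(\<lambda>m. f (Suc m)) sums (- z * bessel_E (\<mu> + 1) z)"
    using sums_mult[OF summable_sums[OF summable_alt_egf[OF K1]], of "- z"]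
    by (simp add: bessel_E_def alt_egf_def)
  moreover have "f 0 = 0"
    by (simp add: f)
  ultimately have "f sums (- z * bessel_E (\<mu> + 1) z)"
    by (simp add: sums_Suc_iff)
  then have "(\<lambda>m. f m + \<mu> * ?t (?r \<mu>) m) sums (- z * bessel_E (\<mu> + 1) z + \<mu> * bessel_E \<mu> z)"
    using sums_mult[OF summable_sums[OF summable_alt_egf[OF K]], of \<mu>]
    by (intro sums_add) (auto simp: bessel_E_def alt_egf_def)
  then show ?thesis
    by (simp add: f_def bessel_E_def alt_egf_def sums_iff)
qed

text \<open>Termwise differentiation, justified by the Weierstrass M-test on \<open>{-R..R}\<close>;
  the choice of \<open>R\<close> puts \<mu> in the interior.\<close>

lemma DERIV_bessel_E_order: "((\<lambda>\<mu>. bessel_E \<mu> z) has_real_derivative order_deriv_E \<mu> z) (at \<mu>)"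
proof -
  let ?t = "\<lambda>g m \<mu>. (-1) ^ m * g (real m + \<mu> + 1) / fact m * z ^ m"
  define R where "R = \<bar>\<mu>\<bar> + 1"
  obtain K where "\<forall>m. \<forall>\<mu>\<in>{-R..R}. \<bar>rGamma (real m + \<mu> + 1)\<bar> \<le> K \<and> \<bar>rGamma' (real m + \<mu> + 1)\<bar> \<le> K"
    using rGamma_coeffs_bounded[of R] by blast
  then have K: "\<bar>rGamma (real m + \<mu> + 1)\<bar> \<le> K" "\<bar>rGamma' (real m + \<mu> + 1)\<bar> \<le> K"
    if "\<mu> \<in> {-R..R}" for m \<mu>
    using that by simp_all
  have \<mu>: "\<mu> \<in> {-R..R}" "\<mu> \<in> interior {-R..R}"
    by (auto simp: R_def)
  have "((\<lambda>\<mu>. \<Sum>m. ?t rGamma m \<mu>) has_real_derivative (\<Sum>m. ?t rGamma' m \<mu>)) (at \<mu>)"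
  proof (rule has_field_derivative_series'(2)[where S = "{-R..R}", OF _ _ _ \<mu>(1) _ \<mu>(2)])
    show "(?t rGamma m has_real_derivative ?t rGamma' m \<nu>) (at \<nu> within {-R..R})" for m \<nu>
      using DERIV_cmult[OF DERIV_rGamma_add[of "real m + 1" \<nu>], of "(-1) ^ m / fact m * z ^ m"]
      by - (rule has_field_derivative_at_within, simp add: ac_simps)
    show "uniformly_convergent_on {-R..R} (\<lambda>n \<nu>. \<Sum>m<n. ?t rGamma' m \<nu>)"
      using K(2) by (intro Weierstrass_m_test'[OF _ summable_alt_egf_bound[of K z]])
        (auto simp only: real_norm_def intro!: alt_egf_term_le)
    show "summable (\<lambda>m. ?t rGamma m \<mu>)"
      using K(1)[OF \<mu>(1)] by (rule summable_alt_egf)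
  qed auto
  then show ?thesis
    by (simp add: bessel_E_def order_deriv_E_def alt_egf_def)
qed

text \<open>The left side has derivative 0 in \<open>z\<close>, so it equals its value at 0, where
  the first product vanishes and the reflection formula evaluates the second.\<close>

lemma bessel_E_wronskian:
  "z * bessel_E (t + 1) z * bessel_E (- t) z + bessel_E t z * bessel_E (- t - 1) z = - sin (pi * t) / pi"
proof -
  note [derivative_intros] = DERIV_chain'[OF _ DERIV_bessel_E]
  let ?W = "\<lambda>z. z * bessel_E (t + 1) z * bessel_E (- t) z + bessel_E t z * bessel_E (- t - 1) z"
  have "(?W has_real_derivative 0) (at y)" for y
  proof -
    have "bessel_E t y = (t + 1) * bessel_E (t + 1) y - y * bessel_E (t + 2) y"
      using bessel_E_rec[of "t + 1" y] by (simp add: add_ac)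
    moreover have "bessel_E (- t - 1) y = - t * bessel_E (- t) y - y * bessel_E (1 - t) y"
      using bessel_E_rec[of "- t" y] by simp
    ultimately show ?thesis
      by (auto intro!: derivative_eq_intros simp: add_ac) (simp add: algebra_simps)
  qed
  then have "?W z = ?W 0"
    by (intro DERIV_isconst_all allI)
  also have "\<dots> = rGamma (t + 1) * rGamma (- t)"
    by (simp add: bessel_E_def alt_egf_0)
  also have "\<dots> = - sin (pi * t) / pi"
    using rGamma_reflection_real[of "- t"] by (simp add: add_ac mult_ac)
  finally show ?thesis .
qed

subsection \<open>Recurrences and Wronskians\<close>

lemma bessel_J_eq:
  assumes "x > 0"
  shows "bessel_J \<mu> x = (x / 2) powr \<mu> * bessel_E \<mu> ((x / 2)\<^sup>2)"
proof -
  let ?t = "\<lambda>m. (-1) ^ m * rGamma (real m + \<mu> + 1) / fact m * ((x / 2)\<^sup>2) ^ m"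
  obtain K where "\<forall>m. \<bar>rGamma (real m + \<mu> + 1)\<bar> \<le> K"
    using rGamma_coeffs_bounded_at by blast
  then have "summable ?t"
    by (intro summable_alt_egf[of _ K]) simp
  moreover have "(x / 2) powr (2 * real m + \<mu>) = (x / 2) powr \<mu> * ((x / 2)\<^sup>2) ^ m" for m
  proof -
    have "(x / 2) powr (2 * real m + \<mu>) = (x / 2) powr (real (2 * m)) * (x / 2) powr \<mu>"
      by (simp add: powr_add)
    also have "(x / 2) powr (real (2 * m)) = ((x / 2)\<^sup>2) ^ m"
      using assms by (simp only: powr_realpow[of "x / 2"] power_mult half_gt_zero)
    finally show ?thesis
      by simp
  qed
  ultimately show ?thesis
    using suminf_mult[of ?t "(x / 2) powr \<mu>"]
    by (simp add: bessel_J_def bessel_E_def alt_egf_def mult_ac)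
qed

text \<open>The product rule in \<mu> for the factorization \<open>bessel_J_eq\<close>; the
  logarithm comes from the power.\<close>

definition order_deriv_J :: "real \<Rightarrow> real \<Rightarrow> real" where
  "order_deriv_J \<mu> x = ln (x / 2) * bessel_J \<mu> x + (x / 2) powr \<mu> * order_deriv_E \<mu> ((x / 2)\<^sup>2)"

lemma powr_rec: "x > 0 \<Longrightarrow> x powr (\<mu> + 1) = x * x powr \<mu>" "x > 0 \<Longrightarrow> x powr (\<mu> - 1) = x powr \<mu> / x"
  for x :: real
  by (simp_all add: powr_add powr_diff)

lemma bessel_J_rec:
  assumes "x > 0"
  shows "bessel_J (\<mu> - 1) x + bessel_J (\<mu> + 1) x = 2 * \<mu> / x * bessel_J \<mu> x"
  using assms
  by (simp add: bessel_J_eq powr_rec bessel_E_rec[of \<mu>]) (simp add: field_simps power2_eq_square)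

lemma DERIV_bessel_J:
  assumes "x > 0"
  shows "(bessel_J \<mu> has_real_derivative \<mu> / x * bessel_J \<mu> x - bessel_J (\<mu> + 1) x) (at x)"
proof (rule has_field_derivative_transform_within_open[where S = "{0<..}"])
  note [derivative_intros] = DERIV_chain'[OF _ DERIV_bessel_E]
  show "((\<lambda>x. (x / 2) powr \<mu> * bessel_E \<mu> ((x / 2)\<^sup>2)) has_real_derivative
      \<mu> / x * bessel_J \<mu> x - bessel_J (\<mu> + 1) x) (at x)"
    using assms
    by (auto intro!: derivative_eq_intros simp: bessel_J_eq powr_rec)
       (simp add: field_simps power2_eq_square)
qed (use assms in \<open>auto simp: bessel_J_eq\<close>)

lemma DERIV_bessel_J_order:
  assumes "x > 0"
  shows "((\<lambda>\<mu>. bessel_J \<mu> x) has_real_derivative order_deriv_J \<mu> x) (at \<mu>)"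
  using assms
  by (auto intro!: derivative_eq_intros DERIV_bessel_E_order simp: bessel_J_eq order_deriv_J_def)

lemma DERIV_bessel_J_order_chain [derivative_intros]:
  "x > 0 \<Longrightarrow> (f has_real_derivative f') (at t) \<Longrightarrow>
    ((\<lambda>t. bessel_J (f t) x) has_real_derivative order_deriv_J (f t) x * f') (at t)"
  using DERIV_chain'[OF _ DERIV_bessel_J_order] by (simp add: mult.commute)

text \<open>The summand \<open>2 / x * bessel_J \<mu> x\<close> arises from the factor \<mu> on the
  right of \<open>bessel_J_rec\<close>.\<close>

lemma order_deriv_J_rec:
  assumes "x > 0"
  shows "order_deriv_J (\<mu> - 1) x + order_deriv_J (\<mu> + 1) x = 2 * \<mu> / x * order_deriv_J \<mu> x + 2 / x * bessel_J \<mu> x"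
proof -
  have "((\<lambda>\<mu>. bessel_J (\<mu> - 1) x + bessel_J (\<mu> + 1) x) has_real_derivative
      order_deriv_J (\<mu> - 1) x + order_deriv_J (\<mu> + 1) x) (at \<mu>)"
    using assms by (auto intro!: derivative_eq_intros)
  moreover have "((\<lambda>\<mu>. 2 * \<mu> / x * bessel_J \<mu> x) has_real_derivative
      2 * \<mu> / x * order_deriv_J \<mu> x + 2 / x * bessel_J \<mu> x) (at \<mu>)"
    using assms by (auto intro!: derivative_eq_intros simp: add_divide_distrib mult_ac)
  ultimately show ?thesis
    using assms by (simp add: bessel_J_rec DERIV_unique)
qed

lemma DERIV_order_deriv_J:
  assumes "x > 0"
  shows "(order_deriv_J \<mu> has_real_derivative
      \<mu> / x * order_deriv_J \<mu> x + bessel_J \<mu> x / x - order_deriv_J (\<mu> + 1) x) (at x)"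
proof -
  note [derivative_intros] = DERIV_chain'[OF _ DERIV_order_deriv_E] DERIV_bessel_J
  show ?thesis
    unfolding order_deriv_J_def[abs_def] using assms
    by (auto intro!: derivative_eq_intros simp: powr_rec)
       (simp add: field_simps power2_eq_square)
qed

text \<open>The left side is the Wronskian of \<open>J\<close> at orders \<open>t\<close> and
  \<open>- t\<close>, with derivatives replaced by neighbouring orders. It degenerates at integers
  \<open>t\<close>.\<close>

lemma bessel_J_wronskian:
  assumes "x > 0"
  shows "bessel_J (t + 1) x * bessel_J (- t) x + bessel_J t x * bessel_J (- t - 1) x
    = - 2 * sin (pi * t) / (pi * x)"
proof -
  let ?z = "(x / 2)\<^sup>2"
  have "(x / 2) powr t > 0"
    using assms by simp
  then have "bessel_J (t + 1) x * bessel_J (- t) x + bessel_J t x * bessel_J (- t - 1) x =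
      2 / x * (?z * bessel_E (t + 1) ?z * bessel_E (- t) ?z + bessel_E t ?z * bessel_E (- t - 1) ?z)"
    using assms
    by (simp add: bessel_J_eq powr_rec powr_minus_divide) (simp add: field_simps power2_eq_square)
  then show ?thesis
    unfolding bessel_E_wronskian by simp
qed

text \<open>The \<open>t\<close>-derivative of \<open>bessel_J_wronskian\<close>: at integers, where
  the sine vanishes, the cosine survives. The minus signs come from the inner orders
  \<open>- t\<close> and \<open>- t - 1\<close>.\<close>

lemma order_deriv_J_wronskian:
  assumes "x > 0"
  shows "order_deriv_J (t + 1) x * bessel_J (- t) x - bessel_J (t + 1) x * order_deriv_J (- t) x
    + order_deriv_J t x * bessel_J (- t - 1) x - bessel_J t x * order_deriv_J (- t - 1) x
    = - 2 * cos (pi * t) / x"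
proof -
  have "((\<lambda>t. bessel_J (t + 1) x * bessel_J (- t) x + bessel_J t x * bessel_J (- t - 1) x)
      has_real_derivative order_deriv_J (t + 1) x * bessel_J (- t) x - bessel_J (t + 1) x * order_deriv_J (- t) x
    + order_deriv_J t x * bessel_J (- t - 1) x - bessel_J t x * order_deriv_J (- t - 1) x) (at t)"
    using assms by (auto intro!: derivative_eq_intros)
  moreover have "((\<lambda>t. - 2 * sin (pi * t) / (pi * x)) has_real_derivative - 2 * cos (pi * t) / x) (at t)"
    using assms by (auto intro!: derivative_eq_intros)
  ultimately show ?thesis
    using assms by (simp add: bessel_J_wronskian DERIV_unique)
qed

section \<open>Integer orders and the Bessel function of the second kind\<close>

text \<open>Strong induction, as the recurrence reaches back two orders; for \<open>n = 1\<close> it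
  is the recurrence at order 0, whose right side vanishes.\<close>

lemma bessel_J_minus_of_nat:
  assumes "x > 0"
  shows "bessel_J (- real n) x = (-1) ^ n * bessel_J (real n) x"
proof (induction n rule: nat_less_induct)
  case (1 n)
  show ?case
  proof (cases n)
    case (Suc k)
    show ?thesis
    proof (cases k)
      case 0
      then show ?thesis
        using bessel_J_rec[OF assms, of 0] Suc by simp
    next
      case (Suc j)
      have n: "n = Suc (Suc j)"
        using \<open>n = Suc k\<close> Suc by simp
      define r where "r = 2 * (1 + real j) / x * bessel_J (1 + real j) x"
      have IH: "bessel_J (- real j) x = (-1) ^ j * bessel_J (real j) x"
        "bessel_J (- 1 - real j) x = - ((-1) ^ j * bessel_J (1 + real j) x)"
        using 1 n by (auto dest: spec[of _ j] spec[of _ "Suc j"])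
      have "bessel_J (real j) x + bessel_J (real n) x = r"
        using bessel_J_rec[OF assms, of "1 + real j"] n by (simp add: r_def add_ac)
      moreover have "bessel_J (- real n) x + bessel_J (- real j) x = (-1) ^ j * r"
      proof -
        have "- 1 - real j - 1 = - real n" "- 1 - real j + 1 = - real j"
          using n by simp_all
        then have "bessel_J (- real n) x + bessel_J (- real j) x
            = 2 * (- 1 - real j) / x * bessel_J (- 1 - real j) x"
          using bessel_J_rec[OF assms, of "- 1 - real j"] by simp
        also have "\<dots> = (-1) ^ j * r"
          unfolding IH r_def using assms by (simp add: field_simps)
        finally show ?thesis .
      qed
      ultimately have "bessel_J (- real n) x = (-1) ^ j * (bessel_J (real j) x + bessel_J (real n) x)
          - (-1) ^ j * bessel_J (real j) x"
        by (simp add: IH)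
      then show ?thesis
        using n by (simp add: distrib_left)
    qed
  qed simp
qed

lemma cos_Ints_pi_square: "\<mu> \<in> \<int> \<Longrightarrow> cos (\<mu> * pi) * cos (\<mu> * pi) = 1" for \<mu> :: real
proof -
  assume "\<mu> \<in> \<int>"
  then have "sin (\<mu> * pi) = 0"
    by (auto simp: sin_zero_iff_int2 elim!: Ints_cases)
  then show ?thesis
    using sin_cos_squared_add[of "\<mu> * pi"] by (simp add: power2_eq_square)
qed

text \<open>Writing the sign as a cosine treats integers of both signs alike and matches the factor
  in \<open>bessel_Y_nonint\<close>.\<close>

lemma bessel_J_minus_Ints:
  assumes "x > 0" "\<mu> \<in> \<int>"
  shows "bessel_J (- \<mu>) x = cos (\<mu> * pi) * bessel_J \<mu> x"
proof -
  obtain i where i: "\<mu> = of_int i"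
    using assms(2) by (rule Ints_cases)
  obtain n where "\<mu> = real n \<or> \<mu> = - real n"
    unfolding i by (cases i rule: int_cases2) auto
  then show ?thesis
    using bessel_J_minus_of_nat[OF assms(1), of n] by (auto simp flip: power_mult_distrib)
qed

lemma bessel_Y_Ints:
  assumes "x > 0" "\<mu> \<in> \<int>"
  shows "bessel_Y \<mu> x = (order_deriv_J \<mu> x + cos (\<mu> * pi) * order_deriv_J (- \<mu>) x) / pi"
proof -
  let ?c = "cos (\<mu> * pi)"
  let ?N = "\<lambda>t. bessel_J t x * cos (t * pi) - bessel_J (- t) x"
  have c: "?c * ?c = 1"
    using assms(2) by (rule cos_Ints_pi_square)
  have s: "sin (\<mu> * pi) = 0"
    using assms(2) by (auto simp: sin_zero_iff_int2 elim!: Ints_cases)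
  have "(?N has_real_derivative order_deriv_J \<mu> x * ?c + order_deriv_J (- \<mu>) x) (at \<mu>)"
    using assms(1) s by (auto intro!: derivative_eq_intros)
  moreover have "((\<lambda>t. sin (t * pi)) has_real_derivative pi * ?c) (at \<mu>)"
    by (auto intro!: derivative_eq_intros)
  moreover have "?N \<mu> = 0"
    using bessel_J_minus_Ints[OF assms] by simp
  \<comment> \<open>L'Hospital's rule by hand: \<open>?N\<close> and the sine both vanish at \<mu>,
    so each difference quotient tends to a derivative, and the lower limit \<open>pi * ?c\<close> is
    nonzero since \<open>?c\<close> squares to 1.\<close>
  ultimately have "((\<lambda>t. (?N t / (t - \<mu>)) / (sin (t * pi) / (t - \<mu>))) \<longlongrightarrow>
      (order_deriv_J \<mu> x * ?c + order_deriv_J (- \<mu>) x) / (pi * ?c)) (at \<mu>)"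
    using s c by (intro tendsto_divide) (auto simp: has_field_derivative_iff)
  moreover have "\<forall>\<^sub>F t in at \<mu>. (?N t / (t - \<mu>)) / (sin (t * pi) / (t - \<mu>)) = bessel_Y_nonint t x"
    using eventually_neq_at_within[of \<mu>]
    by eventually_elim (simp add: bessel_Y_nonint_def)
  ultimately have "((\<lambda>t. bessel_Y_nonint t x) \<longlongrightarrow> (order_deriv_J \<mu> x * ?c + order_deriv_J (- \<mu>) x) / (pi * ?c)) (at \<mu>)"
    by (rule Lim_transform_eventually)
  then have "bessel_Y \<mu> x = (order_deriv_J \<mu> x * ?c + order_deriv_J (- \<mu>) x) / (pi * ?c)"
    using assms(2) by (simp add: bessel_Y_def tendsto_Lim)
  also have "\<dots> = (order_deriv_J \<mu> x + ?c * order_deriv_J (- \<mu>) x) / pi"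
  proof -
    have "(a * c + b) / (pi * c) = (a + c * b) / pi" if "c = 1 \<or> c = - 1" for a b c
      using that by (auto simp: field_simps)
    then show ?thesis
      using c by (simp add: square_eq_1_iff)
  qed
  finally show ?thesis .
qed

lemma cos_sin_shift_pi:
  "cos ((\<mu> + 1) * pi) = - cos (\<mu> * pi)" "cos ((\<mu> - 1) * pi) = - cos (\<mu> * pi)"
  "sin ((\<mu> + 1) * pi) = - sin (\<mu> * pi)" "sin ((\<mu> - 1) * pi) = - sin (\<mu> * pi)"
  by (simp_all add: algebra_simps)

lemma Ints_shift_iff: "\<mu> + 1 \<in> \<int> \<longleftrightarrow> \<mu> \<in> \<int>" "\<mu> - 1 \<in> \<int> \<longleftrightarrow> \<mu> \<in> \<int>" for \<mu> :: real
  by (metis Ints_1 Ints_add Ints_diff add_diff_cancel_right' diff_add_cancel)+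

lemma sin_pi_nonint: "\<mu> \<notin> \<int> \<Longrightarrow> sin (\<mu> * pi) \<noteq> 0"
  by (auto simp: sin_zero_iff_int2)

lemma bessel_Y_rec:
  assumes "x > 0"
  shows "bessel_Y (\<mu> - 1) x + bessel_Y (\<mu> + 1) x = 2 * \<mu> / x * bessel_Y \<mu> x"
proof (cases "\<mu> \<in> \<int>")
  case True
  let ?c = "cos (\<mu> * pi)"
  have "pi * (bessel_Y (\<mu> - 1) x + bessel_Y (\<mu> + 1) x) =
      (order_deriv_J (\<mu> - 1) x + order_deriv_J (\<mu> + 1) x) - ?c * (order_deriv_J (- \<mu> - 1) x + order_deriv_J (- \<mu> + 1) x)"
    using True assms by (simp add: bessel_Y_Ints Ints_shift_iff cos_sin_shift_pi) (simp add: field_simps)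
  also have "\<dots> = 2 * \<mu> / x * (order_deriv_J \<mu> x + ?c * order_deriv_J (- \<mu>) x)
      + 2 / x * (bessel_J \<mu> x - ?c * bessel_J (- \<mu>) x)"
    unfolding order_deriv_J_rec[OF assms] by (simp add: algebra_simps)
  \<comment> \<open>Hence the inhomogeneous terms contributed by \<open>order_deriv_J_rec\<close> at
    \<mu> and \<open>- \<mu>\<close> cancel.\<close>
  also have "?c * bessel_J (- \<mu>) x = bessel_J \<mu> x"
    using cos_Ints_pi_square[OF True] by (simp add: bessel_J_minus_Ints[OF assms True] flip: mult.assoc)
  finally show ?thesis
    using True assms by (simp add: bessel_Y_Ints field_simps)
next
  case False
  have "bessel_Y (\<mu> - 1) x + bessel_Y (\<mu> + 1) x =
      ((bessel_J (\<mu> - 1) x + bessel_J (\<mu> + 1) x) * cos (\<mu> * pi)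
       + (bessel_J (- \<mu> - 1) x + bessel_J (- \<mu> + 1) x)) / sin (\<mu> * pi)"
    using False sin_pi_nonint[OF False]
    by (simp add: bessel_Y_def bessel_Y_nonint_def Ints_shift_iff cos_sin_shift_pi) (simp add: field_simps)
  also have "\<dots> = 2 * \<mu> / x * bessel_Y \<mu> x"
    unfolding bessel_J_rec[OF assms] using False sin_pi_nonint[OF False] assms
    by (simp add: bessel_Y_def bessel_Y_nonint_def field_simps)
  finally show ?thesis .
qed

lemma DERIV_bessel_Y:
  assumes "x > 0"
  shows "(bessel_Y \<mu> has_real_derivative \<mu> / x * bessel_Y \<mu> x - bessel_Y (\<mu> + 1) x) (at x)"
proof (cases "\<mu> \<in> \<int>")
  case True
  let ?c = "cos (\<mu> * pi)"
  let ?D = "(\<mu> / x * order_deriv_J \<mu> x + bessel_J \<mu> x / x - order_deriv_J (\<mu> + 1) x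
    + ?c * (- \<mu> / x * order_deriv_J (- \<mu>) x + bessel_J (- \<mu>) x / x - order_deriv_J (- \<mu> + 1) x)) / pi"
  have "(bessel_Y \<mu> has_real_derivative ?D) (at x)"
  proof (rule has_field_derivative_transform_within_open[where S = "{0<..}"])
    show "((\<lambda>x. (order_deriv_J \<mu> x + cos (\<mu> * pi) * order_deriv_J (- \<mu>) x) / pi) has_real_derivative ?D) (at x)"
      by (intro DERIV_cdivide DERIV_add DERIV_cmult DERIV_order_deriv_J assms)
  qed (use assms True in \<open>auto simp: bessel_Y_Ints\<close>)
  moreover have "?D = \<mu> / x * bessel_Y \<mu> x - bessel_Y (\<mu> + 1) x"
  proof -
    \<comment> \<open>Differentiation in \<open>x\<close> produces order \<open>- \<mu> + 1\<close>,
      whereas \<open>bessel_Y (\<mu> + 1)\<close> involves \<open>- (\<mu> + 1)\<close>; the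
      recurrence exchanges the two.\<close>
    have "order_deriv_J (- \<mu> + 1) x = - 2 * \<mu> / x * order_deriv_J (- \<mu>) x + 2 / x * bessel_J (- \<mu>) x - order_deriv_J (- \<mu> - 1) x"
      using order_deriv_J_rec[OF assms, of "- \<mu>"] by simp
    then have "?D = (\<mu> / x * (order_deriv_J \<mu> x + ?c * order_deriv_J (- \<mu>) x)
        + (bessel_J \<mu> x - ?c * bessel_J (- \<mu>) x) / x - (order_deriv_J (\<mu> + 1) x - ?c * order_deriv_J (- \<mu> - 1) x)) / pi"
      using assms by (simp only:) (simp add: field_simps)
    also have "?c * bessel_J (- \<mu>) x = bessel_J \<mu> x"
      using cos_Ints_pi_square[OF True] by (simp add: bessel_J_minus_Ints[OF assms True] flip: mult.assoc)
    also have "- \<mu> - 1 = - (\<mu> + 1)"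
      by simp
    finally show ?thesis
      using True assms by (simp add: bessel_Y_Ints Ints_shift_iff cos_sin_shift_pi diff_divide_distrib)
  qed
  ultimately show ?thesis
    by simp
next
  case False
  let ?D = "((\<mu> / x * bessel_J \<mu> x - bessel_J (\<mu> + 1) x) * cos (\<mu> * pi)
    - (- \<mu> / x * bessel_J (- \<mu>) x - bessel_J (- \<mu> + 1) x)) / sin (\<mu> * pi)"
  have "((\<lambda>x. (bessel_J \<mu> x * cos (\<mu> * pi) - bessel_J (- \<mu>) x) / sin (\<mu> * pi)) has_real_derivative ?D) (at x)"
    by (intro DERIV_cdivide DERIV_diff DERIV_cmult_right DERIV_bessel_J assms)
  then have "(bessel_Y \<mu> has_real_derivative ?D) (at x)"
    using False by (simp add: bessel_Y_def[abs_def] bessel_Y_nonint_def[abs_def])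
  moreover have "?D = \<mu> / x * bessel_Y \<mu> x - bessel_Y (\<mu> + 1) x"
  proof -
    have J: "bessel_J (- \<mu> + 1) x = - 2 * \<mu> / x * bessel_J (- \<mu>) x - bessel_J (- \<mu> - 1) x"
      using bessel_J_rec[OF assms, of "- \<mu>"] by simp
    show ?thesis
      unfolding J using False sin_pi_nonint[OF False] assms
      by (simp add: bessel_Y_def bessel_Y_nonint_def Ints_shift_iff cos_sin_shift_pi)
         (simp add: field_simps)
  qed
  ultimately show ?thesis
    by simp
qed

text \<open>At non-integer order the sine in the denominator of \<open>Y\<close> cancels the one in
  \<open>bessel_J_wronskian\<close>; at integer order \<open>order_deriv_J_wronskian\<close> takes
  its place.\<close>

lemma bessel_JY_wronskian:
  assumes "x > 0"
  shows "bessel_J (\<mu> + 1) x * bessel_Y \<mu> x - bessel_J \<mu> x * bessel_Y (\<mu> + 1) x = 2 / (pi * x)"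
proof (cases "\<mu> \<in> \<int>")
  case True
  let ?c = "cos (\<mu> * pi)"
  have c: "?c * ?c = 1"
    using True by (rule cos_Ints_pi_square)
  have J: "bessel_J (- \<mu>) x = ?c * bessel_J \<mu> x" "bessel_J (- \<mu> - 1) x = - ?c * bessel_J (\<mu> + 1) x"
    using bessel_J_minus_Ints[OF assms, of \<mu>] bessel_J_minus_Ints[OF assms, of "\<mu> + 1"] True
    by (simp_all add: Ints_shift_iff cos_sin_shift_pi)
  have K: "pi * bessel_Y \<mu> x = order_deriv_J \<mu> x + ?c * order_deriv_J (- \<mu>) x"
    "pi * bessel_Y (\<mu> + 1) x = order_deriv_J (\<mu> + 1) x - ?c * order_deriv_J (- \<mu> - 1) x"
    using True assms by (simp_all add: bessel_Y_Ints Ints_shift_iff cos_sin_shift_pi)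
  have "pi * (bessel_J (\<mu> + 1) x * bessel_Y \<mu> x - bessel_J \<mu> x * bessel_Y (\<mu> + 1) x) =
      bessel_J (\<mu> + 1) x * (pi * bessel_Y \<mu> x) - bessel_J \<mu> x * (pi * bessel_Y (\<mu> + 1) x)"
    by (simp add: algebra_simps)
  also have "\<dots> = (?c * ?c) * (bessel_J (\<mu> + 1) x * order_deriv_J \<mu> x - bessel_J \<mu> x * order_deriv_J (\<mu> + 1) x)
      + ?c * (bessel_J (\<mu> + 1) x * order_deriv_J (- \<mu>) x + bessel_J \<mu> x * order_deriv_J (- \<mu> - 1) x)"
    unfolding K by (simp add: c) (simp add: algebra_simps)
  also have "\<dots> = - ?c * (order_deriv_J (\<mu> + 1) x * bessel_J (- \<mu>) x - bessel_J (\<mu> + 1) x * order_deriv_J (- \<mu>) x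
      + order_deriv_J \<mu> x * bessel_J (- \<mu> - 1) x - bessel_J \<mu> x * order_deriv_J (- \<mu> - 1) x)"
    unfolding J by (simp add: algebra_simps)
  also have "\<dots> = 2 * (?c * ?c) / x"
    unfolding order_deriv_J_wronskian[OF assms] by (simp add: mult_ac)
  finally show ?thesis
    unfolding c using assms by (simp add: field_simps)
next
  case False
  have "bessel_J (\<mu> + 1) x * bessel_Y \<mu> x - bessel_J \<mu> x * bessel_Y (\<mu> + 1) x =
      - (bessel_J (\<mu> + 1) x * bessel_J (- \<mu>) x + bessel_J \<mu> x * bessel_J (- \<mu> - 1) x) / sin (\<mu> * pi)"
    using False sin_pi_nonint[OF False]
    by (simp add: bessel_Y_def bessel_Y_nonint_def Ints_shift_iff cos_sin_shift_pi)
       (simp add: field_simps)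
  also have "\<dots> = 2 / (pi * x)"
    unfolding bessel_J_wronskian[OF assms] using sin_pi_nonint[OF False]
    by (simp add: mult_ac)
  finally show ?thesis .
qed

section \<open>Recurrences, common zeros and Bessel's equation for cylinder functions\<close>

lemma cylinder_rec:
  assumes "x > 0"
  shows "cylinder_C \<alpha> (\<mu> - 1) x + cylinder_C \<alpha> (\<mu> + 1) x = 2 * \<mu> / x * cylinder_C \<alpha> \<mu> x"
proof -
  have "cylinder_C \<alpha> (\<mu> - 1) x + cylinder_C \<alpha> (\<mu> + 1) x = cos \<alpha> * (bessel_J (\<mu> - 1) x + bessel_J (\<mu> + 1) x)
      - sin \<alpha> * (bessel_Y (\<mu> - 1) x + bessel_Y (\<mu> + 1) x)"
    by (simp add: cylinder_C_def algebra_simps)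
  then show ?thesis
    unfolding bessel_J_rec[OF assms] bessel_Y_rec[OF assms]
    by (simp add: cylinder_C_def algebra_simps)
qed

lemma DERIV_cylinder_down:
  assumes "x > 0"
  shows "(cylinder_C \<alpha> \<mu> has_real_derivative \<mu> / x * cylinder_C \<alpha> \<mu> x - cylinder_C \<alpha> (\<mu> + 1) x) (at x)"
proof -
  have "((\<lambda>x. cos \<alpha> * bessel_J \<mu> x - sin \<alpha> * bessel_Y \<mu> x) has_real_derivative
      cos \<alpha> * (\<mu> / x * bessel_J \<mu> x - bessel_J (\<mu> + 1) x)
      - sin \<alpha> * (\<mu> / x * bessel_Y \<mu> x - bessel_Y (\<mu> + 1) x)) (at x)"
    by (intro DERIV_diff DERIV_cmult DERIV_bessel_J DERIV_bessel_Y assms)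
  then show ?thesis
    unfolding cylinder_C_def[abs_def] by (simp add: algebra_simps)
qed

lemma DERIV_cylinder_up:
  assumes "x > 0"
  shows "(cylinder_C \<alpha> \<mu> has_real_derivative cylinder_C \<alpha> (\<mu> - 1) x - \<mu> / x * cylinder_C \<alpha> \<mu> x) (at x)"
proof -
  have "\<mu> / x * cylinder_C \<alpha> \<mu> x - cylinder_C \<alpha> (\<mu> + 1) x = cylinder_C \<alpha> (\<mu> - 1) x - \<mu> / x * cylinder_C \<alpha> \<mu> x"
    using cylinder_rec[OF assms, of \<alpha> \<mu>] by (simp add: field_simps)
  then show ?thesis
    using DERIV_cylinder_down[OF assms, of \<alpha> \<mu>] by (simp only:)
qed

text \<open>A common zero would put the nonzero vector \<open>(cos \<alpha>, - sin \<alpha>)\<close>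
  in the kernel of the matrix of \<open>J\<close> and \<open>Y\<close> at orders \<mu> and
  \<open>\<mu> + 1\<close>, whose determinant is \<open>- 2 / (pi * x)\<close>.\<close>

lemma cylinder_no_common_zero:
  assumes "x > 0"
  shows "cylinder_C \<alpha> \<mu> x \<noteq> 0 \<or> cylinder_C \<alpha> (\<mu> + 1) x \<noteq> 0"
proof (rule ccontr)
  assume "\<not> ?thesis"
  then have *: "cos \<alpha> * bessel_J \<mu> x = sin \<alpha> * bessel_Y \<mu> x"
    "cos \<alpha> * bessel_J (\<mu> + 1) x = sin \<alpha> * bessel_Y (\<mu> + 1) x"
    by (auto simp: cylinder_C_def)
  define W where "W = bessel_J (\<mu> + 1) x * bessel_Y \<mu> x - bessel_J \<mu> x * bessel_Y (\<mu> + 1) x"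
  have "cos \<alpha> * W = (cos \<alpha> * bessel_J (\<mu> + 1) x) * bessel_Y \<mu> x - (cos \<alpha> * bessel_J \<mu> x) * bessel_Y (\<mu> + 1) x"
    by (simp add: W_def algebra_simps)
  also have "\<dots> = 0"
    unfolding * by simp
  finally have "cos \<alpha> * W = 0" .
  moreover have "sin \<alpha> * W = bessel_J (\<mu> + 1) x * (sin \<alpha> * bessel_Y \<mu> x) - bessel_J \<mu> x * (sin \<alpha> * bessel_Y (\<mu> + 1) x)"
    by (simp add: W_def algebra_simps)
  then have "sin \<alpha> * W = 0"
    unfolding *[symmetric] by simp
  moreover have "W \<noteq> 0"
    using assms by (simp add: W_def bessel_JY_wronskian)
  ultimately show False
    using sin_cos_squared_add[of \<alpha>] by simp
qed

lemma cylinder_neighbours_nonzero: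
  assumes "x > 0" "cylinder_C \<alpha> \<mu> x = 0"
  shows "cylinder_C \<alpha> (\<mu> - 1) x \<noteq> 0" "cylinder_C \<alpha> (\<mu> + 1) x \<noteq> 0"
  using cylinder_no_common_zero[OF assms(1), of \<alpha> \<mu>] cylinder_no_common_zero[OF assms(1), of \<alpha> "\<mu> - 1"] assms(2)
  by simp_all

lemma continuous_on_cylinder: "A \<subseteq> {0<..} \<Longrightarrow> continuous_on A (cylinder_C \<alpha> \<mu>)"
  by (meson DERIV_cylinder_down DERIV_isCont continuous_at_imp_continuous_on greaterThan_iff subsetD)

text \<open>The differentiated function is \<open>x C'\<close>, so this is Bessel's equation in
  self-adjoint form.\<close>

lemma DERIV_euler_cylinder:
  assumes "x > 0"
  shows "((\<lambda>x. \<mu> * cylinder_C \<alpha> \<mu> x - x * cylinder_C \<alpha> (\<mu> + 1) x) has_real_derivative (\<mu>\<^sup>2 / x - x) * cylinder_C \<alpha> \<mu> x) (at x)"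
proof -
  have "((\<lambda>x. \<mu> * cylinder_C \<alpha> \<mu> x - x * cylinder_C \<alpha> (\<mu> + 1) x) has_real_derivative
     \<mu> * (\<mu> / x * cylinder_C \<alpha> \<mu> x - cylinder_C \<alpha> (\<mu> + 1) x)
     - (1 * cylinder_C \<alpha> (\<mu> + 1) x + (cylinder_C \<alpha> (\<mu> + 1 - 1) x - (\<mu> + 1) / x * cylinder_C \<alpha> (\<mu> + 1) x) * x)) (at x)"
    by (intro DERIV_diff DERIV_cmult DERIV_mult DERIV_ident DERIV_cylinder_down DERIV_cylinder_up[where \<mu> = "\<mu> + 1"] assms)
  moreover have "\<mu> * (\<mu> / x * cylinder_C \<alpha> \<mu> x - cylinder_C \<alpha> (\<mu> + 1) x)
     - (1 * cylinder_C \<alpha> (\<mu> + 1) x + (cylinder_C \<alpha> (\<mu> + 1 - 1) x - (\<mu> + 1) / x * cylinder_C \<alpha> (\<mu> + 1) x) * x) = (\<mu>\<^sup>2 / x - x) * cylinder_C \<alpha> \<mu> x"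
    using assms by (simp add: field_simps power2_eq_square)
  ultimately show ?thesis
    by simp
qed

subsection \<open>Zeros of cylinder functions\<close>

text \<open>With \<open>y = cylinder_C \<alpha> \<mu>\<close>, the function \<open>x y y' + x\<^sup>2 y\<^sup>2\<close> is strictly increasing on \<open>(0, 1)\<close>, whatever
  the order, and vanishes at the zeros of \<open>y\<close>.\<close>

lemma cylinder_zero_below_1_unique:
  assumes "0 < a" "a < b" "b < 1" "cylinder_C \<alpha> \<mu> a = 0"
  shows "cylinder_C \<alpha> \<mu> b \<noteq> 0"
proof -
  define F where "F x = cylinder_C \<alpha> \<mu> x * (\<mu> * cylinder_C \<alpha> \<mu> x - x * cylinder_C \<alpha> (\<mu> + 1) x) + x\<^sup>2 * (cylinder_C \<alpha> \<mu> x)\<^sup>2" for x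
  have "F a < F b"
  proof (rule DERIV_pos_imp_increasing[of a b F])
    fix x assume x: "a \<le> x" "x \<le> b"
    then have x01: "0 < x" "x < 1"
      using assms by auto
    let ?y = "cylinder_C \<alpha> \<mu> x" and ?d = "\<mu> / x * cylinder_C \<alpha> \<mu> x - cylinder_C \<alpha> (\<mu> + 1) x"
    \<comment> \<open>The derivative of \<open>F\<close> with the square completed,
      \<open>?d\<close> being the derivative of the cylinder function. For \<open>x < 1\<close> the
      last coefficient is positive; where \<open>?y = 0\<close>, the square is positive because
      \<open>?d\<close> is nonzero.\<close>
    define F' where "F' = x * (?d + x * ?y)\<^sup>2 + (x - x ^ 3 + \<mu>\<^sup>2 / x) * ?y\<^sup>2"
    have "(F has_real_derivative F') (at x)"
      unfolding F_def[abs_def]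
      by (rule derivative_eq_intros DERIV_cylinder_down DERIV_euler_cylinder x01 refl)+
         (use x01 in \<open>simp add: F'_def field_simps power2_eq_square power3_eq_cube\<close>)
    moreover have "F' > 0"
    proof (cases "?y = 0")
      case True
      then show ?thesis
        using cylinder_neighbours_nonzero(2)[OF x01(1) True] x01 by (simp add: F'_def)
    next
      case False
      have "x ^ 3 < x"
        using x01 power_strict_decreasing[of 1 3 x] by simp
      then have "x - x ^ 3 + \<mu>\<^sup>2 / x > 0"
        using x01 by (simp add: add_pos_nonneg)
      then have "(x - x ^ 3 + \<mu>\<^sup>2 / x) * ?y\<^sup>2 > 0"
        using False by (intro mult_pos_pos) simp_all
      then show ?thesis
        unfolding F'_def using x01 by (intro add_nonneg_pos) simp_all
    qed
    ultimately show "\<exists>y. (F has_real_derivative y) (at x) \<and> 0 < y"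
      by blast
  qed (rule assms)
  then show ?thesis
    using assms(4) by (auto simp: F_def)
qed

text \<open>By continuity an accumulation point \<open>c\<close> of zeros is itself a zero. The
  derivative there is \<open>- cylinder_C \<alpha> (\<mu> + 1) c\<close>, which is nonzero, so
  \<open>c\<close> is isolated.\<close>

lemma finite_cylinder_zeros_Icc:
  assumes "0 < a"
  shows "finite {x\<in>{a..b}. cylinder_C \<alpha> \<mu> x = 0}"
proof (rule ccontr)
  let ?Z = "{x\<in>{a..b}. cylinder_C \<alpha> \<mu> x = 0}"
  assume "infinite ?Z"
  then obtain c where c: "c \<in> {a..b}" "c islimpt ?Z"
    using compact_eq_Bolzano_Weierstrass[of "{a..b}"] compact_Icc by (metis (no_types, lifting) mem_Collect_eq subsetI)
  have "closed ?Z"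
    using continuous_closed_preimage_constant[of "{a..b}" "cylinder_C \<alpha> \<mu>" 0] continuous_on_cylinder[of "{a..b}" \<alpha> \<mu>] assms
    by (simp add: subset_iff)
  then have "c \<in> ?Z"
    using c(2) closed_limpt by blast
  then have "c > 0" "cylinder_C \<alpha> \<mu> c = 0"
    using assms by auto
  then have lim: "((\<lambda>x. (cylinder_C \<alpha> \<mu> x - cylinder_C \<alpha> \<mu> c) / (x - c)) \<longlongrightarrow> - cylinder_C \<alpha> (\<mu> + 1) c) (at c)"
    and "cylinder_C \<alpha> (\<mu> + 1) c \<noteq> 0"
    using DERIV_cylinder_down[of c \<alpha> \<mu>] cylinder_neighbours_nonzero(2)[of c \<alpha> \<mu>] by (auto simp: has_field_derivative_iff)
  then have "\<forall>\<^sub>F x in at c. (cylinder_C \<alpha> \<mu> x - cylinder_C \<alpha> \<mu> c) / (x - c) \<noteq> 0"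
    by (intro tendsto_imp_eventually_ne[OF lim]) simp
  then have "\<forall>\<^sub>F x in at c. x \<notin> ?Z"
    by eventually_elim (auto simp: \<open>cylinder_C \<alpha> \<mu> c = 0\<close>)
  then show False
    using c(2) by (auto simp: islimpt_iff_eventually)
qed

text \<open>Compactness fails at the singular point 0; there the uniqueness of a zero in
  \<open>(0, 1)\<close> takes over. Finiteness is needed to count the zeros in increasing
  order.\<close>

lemma finite_cylinder_zeros_le: "finite {y \<in> cylinder_zeros \<alpha> \<mu>. y \<le> x}"
proof -
  let ?S = "{y. 0 < y \<and> y < 1 \<and> cylinder_C \<alpha> \<mu> y = 0}"
  have "finite ?S"
  proof (cases "?S = {}")
    case False
    then obtain a where "a \<in> ?S"
      by blast
    then have "?S \<subseteq> {a}"
      using cylinder_zero_below_1_unique[of a _ \<alpha> \<mu>] cylinder_zero_below_1_unique[of _ a \<alpha> \<mu>]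
      by (auto simp: not_less_iff_gr_or_eq) (metis linorder_neqE)
    then show ?thesis
      by (rule finite_subset) simp
  qed (simp only: finite.emptyI)
  moreover have "{y \<in> cylinder_zeros \<alpha> \<mu>. y \<le> x} \<subseteq> ?S \<union> {y\<in>{1..x}. cylinder_C \<alpha> \<mu> y = 0}"
    by (auto simp: cylinder_zeros_def)
  ultimately show ?thesis
    using finite_cylinder_zeros_Icc[of 1 x \<alpha> \<mu>] by (simp add: finite_subset)
qed

section \<open>Sturm comparison and arbitrarily large zeros\<close>

text \<open>The comparison function \<open>sin ((x - a) / 2)\<close> is positive between its zeros
  \<open>a\<close> and \<open>a + 2 * pi\<close>. For positive \<open>u\<close> the Wronskian
  \<open>F\<close> would be nondecreasing, yet \<open>F a = u a / 2\<close> is positive and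
  \<open>F (a + 2 * pi) = - u (a + 2 * pi) / 2\<close> negative.\<close>

lemma sturm_no_positive_solution:
  fixes u u' q :: "real \<Rightarrow> real"
  assumes u: "\<And>x. a \<le> x \<Longrightarrow> (u has_real_derivative u' x) (at x)"
    and u': "\<And>x. a \<le> x \<Longrightarrow> (u' has_real_derivative - q x * u x) (at x)"
    and q: "\<And>x. a \<le> x \<Longrightarrow> q x \<ge> 1 / 4"
  shows "\<exists>x\<in>{a..a + 2 * pi}. u x \<le> 0"
proof (rule ccontr)
  assume "\<not> ?thesis"
  then have pos: "u x > 0" if "x \<in> {a..a + 2 * pi}" for x
    using that by force
  \<comment> \<open>the Wronskian of \<open>u\<close> and \<open>sin ((x - a) / 2)\<close>, as in Sturm's comparison theorem\<close>
  define F where "F x = u x * (cos ((x - a) / 2) / 2) - u' x * sin ((x - a) / 2)" for x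
  have "F a \<le> F (a + 2 * pi)"
  proof (rule DERIV_nonneg_imp_nondecreasing[of a _ F])
    fix x assume x: "a \<le> x" "x \<le> a + 2 * pi"
    have "(F has_real_derivative (q x - 1 / 4) * u x * sin ((x - a) / 2)) (at x)"
      unfolding F_def[abs_def] using x
      by (auto intro!: derivative_eq_intros u u') (simp add: field_simps)
    moreover have "sin ((x - a) / 2) \<ge> 0"
      using x by (intro sin_ge_zero) auto
    then have "(q x - 1 / 4) * u x * sin ((x - a) / 2) \<ge> 0"
      using x q[of x] pos[of x] by auto
    ultimately show "\<exists>y. (F has_real_derivative y) (at x) \<and> 0 \<le> y"
      by blast
  qed simp
  then show False
    using pos[of a] pos[of "a + 2 * pi"] by (simp add: F_def)
qed

text \<open>Multiplication by \<open>sqrt x\<close> brings Bessel's equation to the normal form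
  \<open>u'' = - q u\<close>. Comparison for both \<open>u\<close> and \<open>- u\<close> gives
  values of both signs, hence a zero by connectedness.\<close>

lemma cylinder_has_zero_ge:
  "\<exists>x\<ge>a. x \<in> cylinder_zeros \<alpha> \<mu>"
proof -
  \<comment> \<open>Beyond \<open>2 * \<bar>\<mu>\<bar>\<close> the quotient
    \<open>\<mu>\<^sup>2 / x\<^sup>2\<close> is at most 1/4, which keeps \<open>q\<close> above 1/4;
    the entry 1 ensures \<open>x > 0\<close>.\<close>
  define b where "b = Max {a, 1, 2 * \<bar>\<mu>\<bar>}"
  have b: "b \<ge> a" "b \<ge> 1" "b \<ge> 2 * \<bar>\<mu>\<bar>"
    by (auto simp: b_def)
  let ?C = "cylinder_C \<alpha> \<mu>" and ?C1 = "cylinder_C \<alpha> (\<mu> + 1)"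
  define q where "q x = 1 + (1 / 4 - \<mu>\<^sup>2) / x\<^sup>2" for x
  define u where "u x = sqrt x * ?C x" for x
  define u' where "u' x = (\<mu> * ?C x - x * ?C1 x) / sqrt x + ?C x / (2 * sqrt x)" for x
  have E: "(?C has_real_derivative (\<mu> * ?C x - x * ?C1 x) / x) (at x)" if "x > 0" for x
    using DERIV_cylinder_down[OF that, of \<alpha> \<mu>] that by (simp add: diff_divide_distrib)
  have u: "(u has_real_derivative u' x) (at x)" if "x \<ge> b" for x
  proof -
    have x: "x > 0"
      using that b by linarith
    \<comment> \<open>With \<open>x = s * s\<close> the identities to be checked become rational in
      \<open>s\<close>; \<open>e\<close> below stands for \<open>x C'\<close>.\<close>
    define s where "s = sqrt x"
    have s: "s > 0" "s * s = x"
      using x by (auto simp: s_def)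
    have "(u has_real_derivative inverse (sqrt x) / 2 * ?C x + (\<mu> * ?C x - x * ?C1 x) / x * sqrt x) (at x)"
      unfolding u_def[abs_def] by (intro DERIV_mult DERIV_real_sqrt E x)
    moreover have "inverse s / 2 * y + e / (s * s) * s = e / s + y / (2 * s)" for e y
      using s(1) by (simp add: field_simps)
    ultimately show ?thesis
      unfolding s(2) by (simp add: u'_def s_def)
  qed
  have u': "(u' has_real_derivative - q x * u x) (at x)" if "x \<ge> b" for x
  proof -
    have x: "x > 0"
      using that b by linarith
    define s where "s = sqrt x"
    have s: "s > 0" "s * s = x"
      using x by (auto simp: s_def)
    let ?e = "\<mu> * ?C x - x * ?C1 x"
    let ?D = "((\<mu>\<^sup>2 / x - x) * ?C x * s - ?e * (inverse s / 2)) / (s * s)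
      + (?e / x * (2 * s) - ?C x * (2 * (inverse s / 2))) / ((2 * s) * (2 * s))"
    have "(u' has_real_derivative ?D) (at x)"
      unfolding u'_def[abs_def] s_def using x
      by (intro DERIV_add DERIV_divide DERIV_cmult DERIV_real_sqrt DERIV_euler_cylinder E) simp_all
    moreover have "((\<mu>\<^sup>2 / (s * s) - s * s) * y * s - e * (inverse s / 2)) / (s * s)
        + (e / (s * s) * (2 * s) - y * (2 * (inverse s / 2))) / ((2 * s) * (2 * s))
        = - (1 + (1 / 4 - \<mu>\<^sup>2) / (s * s)\<^sup>2) * (s * y)" for e y
      using s(1) by (simp add: divide_simps) (simp add: algebra_simps power2_eq_square power4_eq_xxxx)
    then have "?D = - q x * u x"
      unfolding s(2) by (simp add: q_def u_def s_def)
    ultimately show ?thesis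
      by (simp only:)
  qed
  have q: "q x \<ge> 1 / 4" if "x \<ge> b" for x
  proof -
    have "\<mu>\<^sup>2 \<le> (x / 2)\<^sup>2"
      using that b by (intro power2_le_iff_abs_le[THEN iffD2]) auto
    then have "4 * \<mu>\<^sup>2 \<le> x\<^sup>2"
      by (simp add: power_divide)
    then have "16 * \<mu>\<^sup>2 \<le> 4 + 12 * x\<^sup>2"
      using zero_le_power2[of x] by linarith
    then show ?thesis
      using that b by (simp add: q_def field_simps)
  qed
  let ?I = "{b..b + 2 * pi}"
  have "\<exists>x\<in>?I. u x \<le> 0"
    by (rule sturm_no_positive_solution[of b u u' q]) (erule u u' q)+
  then obtain y where "y \<in> ?I" "u y \<le> 0"
    by blast
  moreover have "\<exists>x\<in>?I. - u x \<le> 0"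
  proof (rule sturm_no_positive_solution[of b "\<lambda>x. - u x" "\<lambda>x. - u' x" q])
    show "((\<lambda>x. - u x) has_real_derivative - u' x) (at x)" if "b \<le> x" for x
      using DERIV_minus[OF u[OF that]] .
    show "((\<lambda>x. - u' x) has_real_derivative - q x * - u x) (at x)" if "b \<le> x" for x
      using DERIV_minus[OF u'[OF that]] by simp
  qed (erule q)
  then obtain z where "z \<in> ?I" "- u z \<le> 0"
    by blast
  ultimately have yz: "y \<in> ?I" "?C y \<le> 0" "z \<in> ?I" "?C z \<ge> 0"
    using b by (auto simp: u_def mult_le_0_iff zero_le_mult_iff)
  have "connected (?C ` ?I)"
    using b by (intro connected_continuous_image continuous_on_cylinder) auto
  then have "0 \<in> ?C ` ?I"
    using yz by (meson connectedD_interval imageI)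
  then obtain x where "x \<in> ?I" "?C x = 0"
    by (auto simp: image_iff)
  then show ?thesis
    using b by (intro exI[of _ x]) (auto simp: cylinder_zeros_def)
qed

lemma infinite_cylinder_zeros: "infinite (cylinder_zeros \<alpha> \<mu>)"
proof
  assume "finite (cylinder_zeros \<alpha> \<mu>)"
  then have "bdd_above (cylinder_zeros \<alpha> \<mu>)"
    by (rule bdd_above_finite)
  then show False
    using cylinder_has_zero_ge[of _ \<alpha> \<mu>]
    by (metis bdd_above.unfold gt_ex linorder_not_less order_less_le_trans)
qed

section \<open>Enumeration of the zeros in increasing order\<close>

text \<open>The counting function is strictly increasing on \<open>S\<close>, which gives
  uniqueness; existence follows by passing repeatedly to the next larger element, the minimum of a
  finite set.\<close>

lemma kth_element_mem:
  fixes S :: "real set"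
  assumes inf: "infinite S" and fin: "\<And>x. finite {y \<in> S. y \<le> x}" and "k \<ge> 1"
  shows "kth_element S k \<in> S"
proof -
  let ?f = "\<lambda>x. card {y \<in> S. y \<le> x}"
  have less: "?f x < ?f y" if "x \<in> S" "y \<in> S" "x < y" for x y
  proof -
    have "{w \<in> S. w \<le> x} \<subseteq> {w \<in> S. w \<le> y}" "y \<in> {w \<in> S. w \<le> y} - {w \<in> S. w \<le> x}"
      using that by auto
    then show ?thesis
      by (intro psubset_card_mono fin) blast
  qed
  have "\<exists>x\<in>S. ?f x = k"
    using \<open>k \<ge> 1\<close>
  proof (induction k rule: dec_induct)
    case base
    obtain z where "z \<in> S"
      using inf by fastforce
    let ?A = "{y \<in> S. y \<le> z}"
    define m where "m = Min ?A"
    have "m \<in> ?A"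
      unfolding m_def using \<open>z \<in> S\<close> by (intro Min_in fin) auto
    moreover have "m \<le> y" if "y \<in> ?A" for y
      unfolding m_def using that by (intro Min_le fin)
    ultimately have "m \<in> S" "{y \<in> S. y \<le> m} = {m}"
      by fastforce+
    then show ?case
      by (intro bexI[of _ m]) simp_all
  next
    case (step n)
    then obtain x where x: "x \<in> S" "?f x = n"
      by blast
    have "\<not> S \<subseteq> {y \<in> S. y \<le> x}"
      using inf fin finite_subset by blast
    then obtain z where z: "z \<in> S" "x < z"
      by fastforce
    let ?A = "{y \<in> S. x < y \<and> y \<le> z}"
    have "finite ?A"
      by (rule finite_subset[OF _ fin[of z]]) auto
    define m where "m = Min ?A"
    have m: "m \<in> ?A"
      unfolding m_def using z by (intro Min_in \<open>finite ?A\<close>) auto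
    have m_le: "m \<le> y" if "y \<in> ?A" for y
      unfolding m_def using that by (intro Min_le \<open>finite ?A\<close>)
    have "{y \<in> S. y \<le> m} = insert m {y \<in> S. y \<le> x}"
      using m m_le by fastforce
    moreover have "m \<notin> {y \<in> S. y \<le> x}"
      using m by auto
    ultimately have "?f m = Suc n"
      using fin[of x] x by simp
    then show ?case
      using m by blast
  qed
  then obtain x where x: "x \<in> S" "?f x = k"
    by blast
  have "kth_element S k = x"
    unfolding kth_element_def
  proof (rule the_equality)
    fix y assume "y \<in> S \<and> ?f y = k"
    then show "y = x"
      using less[of x y] less[of y x] x by (metis linorder_neqE order_less_irrefl)
  qed (use x in simp)
  then show ?thesis
    using x by simp
qed

lemma cylinder_zero_mem: "k \<ge> 1 \<Longrightarrow> cylinder_zero \<alpha> \<mu> k \<in> cylinder_zeros \<alpha> \<mu>"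
  unfolding cylinder_zero_def
  by (intro kth_element_mem infinite_cylinder_zeros finite_cylinder_zeros_le)

subsection \<open>Extrema of the Turanian\<close>

lemma DERIV_turanian:
  assumes "x > 0"
  shows "(turanian \<alpha> \<nu> has_real_derivative
    2 / x * (cylinder_C \<alpha> (\<nu> - 1) x * cylinder_C \<alpha> (\<nu> + 1) x)) (at x)"
proof -
  let ?C = "cylinder_C \<alpha>"
  \<comment> \<open>Lowering the order of the derivative of \<open>C\<close> at
    \<open>\<nu> + 1\<close> and raising it at \<nu> and \<open>\<nu> - 1\<close> keeps all terms
    within three consecutive orders.\<close>
  let ?D = "2 * ?C \<nu> x * (\<nu> / x * ?C \<nu> x - ?C (\<nu> + 1) x)
    - (((\<nu> - 1) / x * ?C (\<nu> - 1) x - ?C (\<nu> - 1 + 1) x) * ?C (\<nu> + 1) x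
       + (?C (\<nu> + 1 - 1) x - (\<nu> + 1) / x * ?C (\<nu> + 1) x) * ?C (\<nu> - 1) x)"
  have "((\<lambda>x. (?C \<nu> x)\<^sup>2) has_real_derivative 2 * ?C \<nu> x * (\<nu> / x * ?C \<nu> x - ?C (\<nu> + 1) x)) (at x)"
    using assms by (auto intro!: derivative_eq_intros DERIV_cylinder_down)
  then have "(turanian \<alpha> \<nu> has_real_derivative ?D) (at x)"
    unfolding turanian_def[abs_def]
    by (intro DERIV_diff DERIV_mult DERIV_cylinder_down DERIV_cylinder_up assms)
  moreover have "?D = ?C \<nu> x * (2 * \<nu> / x * ?C \<nu> x - ?C (\<nu> + 1) x - ?C (\<nu> - 1) x)
      + 2 / x * (?C (\<nu> - 1) x * ?C (\<nu> + 1) x)"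
    using assms by (simp add: field_simps)
  moreover have "2 * \<nu> / x * ?C \<nu> x - ?C (\<nu> + 1) x - ?C (\<nu> - 1) x = 0"
    using cylinder_rec[OF assms, of \<alpha> \<nu>] by simp
  ultimately show ?thesis
    by (simp only: mult_zero_right add_0)
qed

text \<open>The second derivative test: \<open>g\<close> changes sign from plus to minus at
  \<open>c\<close>. Strictness later prevents a point from being a maximum and a minimum at
  once.\<close>

lemma strict_local_max_of_DERIV:
  fixes f g :: "real \<Rightarrow> real"
  assumes f: "\<And>y. y > 0 \<Longrightarrow> (f has_real_derivative g y) (at y)"
    and g: "(g has_real_derivative l) (at c)" and "g c = 0" "l < 0" "c > 0"
  shows "\<forall>\<^sub>F y in at c. f y < f c"
proof -
  obtain d1 where d1: "d1 > 0" "\<And>h. 0 < h \<Longrightarrow> h < d1 \<Longrightarrow> g (c - h) > 0"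
    using DERIV_neg_dec_left[OF g \<open>l < 0\<close>] \<open>g c = 0\<close> by auto
  obtain d2 where d2: "d2 > 0" "\<And>h. 0 < h \<Longrightarrow> h < d2 \<Longrightarrow> g (c + h) < 0"
    using DERIV_neg_dec_right[OF g \<open>l < 0\<close>] \<open>g c = 0\<close> by auto
  \<comment> \<open>The bound \<open>d \<le> c\<close> keeps the neighbourhood inside the positive
    half-line.\<close>
  define d where "d = Min {c, d1, d2}"
  have d: "d > 0" "d \<le> c" "d \<le> d1" "d \<le> d2"
    using \<open>c > 0\<close> d1 d2 by (auto simp: d_def)
  have cont: "continuous_on A f" if "A \<subseteq> {0<..}" for A
    using that by (meson DERIV_isCont continuous_at_imp_continuous_on f greaterThan_iff subsetD)
  have "f y < f c" if "y \<noteq> c" "dist y c < d" for y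
  proof (cases "y < c")
    case True
    show ?thesis
    proof (rule DERIV_pos_imp_increasing_open[OF True])
      fix x assume "y < x" "x < c"
      then show "\<exists>l. (f has_real_derivative l) (at x) \<and> 0 < l"
        using that d f[of x] d1(2)[of "c - x"] by (intro exI[of _ "g x"]) (auto simp: dist_real_def)
    next
      show "continuous_on {y..c} f"
        using that d by (intro cont) (auto simp: dist_real_def)
    qed
  next
    case False
    then have "c < y"
      using that by simp
    then show ?thesis
    proof (rule DERIV_neg_imp_decreasing_open)
      fix x assume "c < x" "x < y"
      then show "\<exists>l. (f has_real_derivative l) (at x) \<and> l < 0"
        using that d f[of x] d2(2)[of "x - c"] by (intro exI[of _ "g x"]) (auto simp: dist_real_def)
    next
      show "continuous_on {c..y} f"
        using \<open>c > 0\<close> by (intro cont) auto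
    qed
  qed
  then show ?thesis
    using d(1) unfolding eventually_at by blast
qed

lemma DERIV_eventually_max_eq_0:
  fixes f :: "real \<Rightarrow> real"
  assumes "(f has_real_derivative l) (at x)" "\<forall>\<^sub>F y in at x. f y \<le> f x"
  shows "l = 0"
proof -
  obtain d where d: "d > 0" "\<And>y. y \<noteq> x \<Longrightarrow> dist y x < d \<Longrightarrow> f y \<le> f x"
    using assms(2) unfolding eventually_at by blast
  have "f y \<le> f x" if "\<bar>x - y\<bar> < d" for y
    using d(2)[of y] that by (cases "y = x") (auto simp: dist_real_def abs_minus_commute)
  then show ?thesis
    using DERIV_local_max[OF assms(1) d(1)] by blast
qed

lemma critical_points_turanian:
  assumes "x > 0" "(turanian \<alpha> \<nu> has_real_derivative 0) (at x)"
  shows "x \<in> cylinder_zeros \<alpha> (\<nu> - 1) \<or> x \<in> cylinder_zeros \<alpha> (\<nu> + 1)"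
  using DERIV_unique[OF DERIV_turanian[OF assms(1)] assms(2)] assms(1)
  by (auto simp: cylinder_zeros_def)

text \<open>Here \<open>p\<close> is the derivative of the Turanian. Only the term differentiating
  the vanishing factor survives; that derivative is \<open>- C\<close> or \<open>C\<close> at order
  \<nu>, and by the recurrence the other factor is \<open>2 * \<nu> / x\<close> times
  \<open>C\<close> at order \<nu>.\<close>

lemma DERIV_cylinder_product_at_zero:
  fixes \<alpha> \<nu> x :: real
  defines "p \<equiv> \<lambda>y. 2 / y * (cylinder_C \<alpha> (\<nu> - 1) y * cylinder_C \<alpha> (\<nu> + 1) y)"
  assumes "x > 0"
  shows "cylinder_C \<alpha> (\<nu> - 1) x = 0 \<Longrightarrow>
      (p has_real_derivative - 4 * \<nu> / x\<^sup>2 * (cylinder_C \<alpha> \<nu> x)\<^sup>2) (at x)"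
    and "cylinder_C \<alpha> (\<nu> + 1) x = 0 \<Longrightarrow>
      (p has_real_derivative 4 * \<nu> / x\<^sup>2 * (cylinder_C \<alpha> \<nu> x)\<^sup>2) (at x)"
proof -
  let ?C = "cylinder_C \<alpha>"
  let ?D = "(- 2 / x\<^sup>2) * (?C (\<nu> - 1) x * ?C (\<nu> + 1) x)
    + (((\<nu> - 1) / x * ?C (\<nu> - 1) x - ?C (\<nu> - 1 + 1) x) * ?C (\<nu> + 1) x
       + (?C (\<nu> + 1 - 1) x - (\<nu> + 1) / x * ?C (\<nu> + 1) x) * ?C (\<nu> - 1) x) * (2 / x)"
  have "((\<lambda>y. 2 / y) has_real_derivative - 2 / x\<^sup>2) (at x)"
    using assms(2) by (auto intro!: derivative_eq_intros simp: power2_eq_square)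
  then have D: "(p has_real_derivative ?D) (at x)"
    unfolding p_def by (intro DERIV_mult DERIV_cylinder_down DERIV_cylinder_up assms(2))
  note rec = cylinder_rec[OF assms(2), of \<alpha> \<nu>]
  show "(p has_real_derivative - 4 * \<nu> / x\<^sup>2 * (?C \<nu> x)\<^sup>2) (at x)" if "?C (\<nu> - 1) x = 0"
    using D rec that by (simp add: power2_eq_square mult_ac)
  show "(p has_real_derivative 4 * \<nu> / x\<^sup>2 * (?C \<nu> x)\<^sup>2) (at x)" if "?C (\<nu> + 1) x = 0"
    using D rec that by (simp add: power2_eq_square mult_ac)
qed

lemma cylinder_nonzero_between:
  assumes "x \<in> cylinder_zeros \<alpha> (\<nu> - 1) \<or> x \<in> cylinder_zeros \<alpha> (\<nu> + 1)"
  shows "cylinder_C \<alpha> \<nu> x \<noteq> 0"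
  using assms cylinder_neighbours_nonzero(2)[of x \<alpha> "\<nu> - 1"] cylinder_neighbours_nonzero(1)[of x \<alpha> "\<nu> + 1"]
  by (auto simp: cylinder_zeros_def)

lemma turanian_at_zero:
  assumes "x \<in> cylinder_zeros \<alpha> (\<nu> - 1) \<or> x \<in> cylinder_zeros \<alpha> (\<nu> + 1)"
  shows "turanian \<alpha> \<nu> x = (cylinder_C \<alpha> \<nu> x)\<^sup>2" "turanian \<alpha> \<nu> x > 0"
  using assms cylinder_nonzero_between[OF assms] by (auto simp: turanian_def cylinder_zeros_def)

lemma turanian_strict_max:
  assumes "\<nu> > 0" "x \<in> cylinder_zeros \<alpha> (\<nu> - 1)"
  shows "\<forall>\<^sub>F y in at x. turanian \<alpha> \<nu> y < turanian \<alpha> \<nu> x"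
proof (rule strict_local_max_of_DERIV[OF DERIV_turanian])
  show "((\<lambda>y. 2 / y * (cylinder_C \<alpha> (\<nu> - 1) y * cylinder_C \<alpha> (\<nu> + 1) y)) has_real_derivative
      - 4 * \<nu> / x\<^sup>2 * (cylinder_C \<alpha> \<nu> x)\<^sup>2) (at x)"
    using assms by (intro DERIV_cylinder_product_at_zero(1)) (auto simp: cylinder_zeros_def)
  show "- 4 * \<nu> / x\<^sup>2 * (cylinder_C \<alpha> \<nu> x)\<^sup>2 < 0"
    using assms cylinder_nonzero_between[of x \<alpha> \<nu>] by (auto simp: cylinder_zeros_def)
qed (use assms in \<open>auto simp: cylinder_zeros_def\<close>)

lemma turanian_strict_min:
  assumes "\<nu> > 0" "x \<in> cylinder_zeros \<alpha> (\<nu> + 1)"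
  shows "\<forall>\<^sub>F y in at x. turanian \<alpha> \<nu> x < turanian \<alpha> \<nu> y"
proof -
  have "\<forall>\<^sub>F y in at x. - turanian \<alpha> \<nu> y < - turanian \<alpha> \<nu> x"
  proof (rule strict_local_max_of_DERIV[OF DERIV_minus[OF DERIV_turanian]])
    show "((\<lambda>y. - (2 / y * (cylinder_C \<alpha> (\<nu> - 1) y * cylinder_C \<alpha> (\<nu> + 1) y))) has_real_derivative
        - (4 * \<nu> / x\<^sup>2 * (cylinder_C \<alpha> \<nu> x)\<^sup>2)) (at x)"
      using assms by (intro DERIV_minus DERIV_cylinder_product_at_zero(2)) (auto simp: cylinder_zeros_def)
    show "- (4 * \<nu> / x\<^sup>2 * (cylinder_C \<alpha> \<nu> x)\<^sup>2) < 0"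
      using assms cylinder_nonzero_between[of x \<alpha> \<nu>] by (auto simp: cylinder_zeros_def)
  qed (use assms in \<open>auto simp: cylinder_zeros_def\<close>)
  then show ?thesis
    by simp
qed

lemma at_within_pos: "x > 0 \<Longrightarrow> at x within {0<..} = at x" for x :: real
  by (intro at_within_open) auto

text \<open>A relative maximum is a critical point, hence a zero of one of the two neighbours. Zeros
  at order \<open>\<nu> + 1\<close> are strict minima, which contradicts even a weak maximum because
  \<open>at x\<close> is a nontrivial filter.\<close>

lemma rel_max_points_turanian:
  assumes "\<nu> > 0"
  shows "rel_max_points (turanian \<alpha> \<nu>) = cylinder_zeros \<alpha> (\<nu> - 1)"
proof (intro equalityI subsetI)
  fix x assume "x \<in> rel_max_points (turanian \<alpha> \<nu>)"
  then have x: "x > 0" "\<forall>\<^sub>F y in at x. turanian \<alpha> \<nu> y \<le> turanian \<alpha> \<nu> x"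
    by (auto simp: rel_max_points_def at_within_pos)
  then have "2 / x * (cylinder_C \<alpha> (\<nu> - 1) x * cylinder_C \<alpha> (\<nu> + 1) x) = 0"
    using DERIV_eventually_max_eq_0[OF DERIV_turanian] by blast
  then have "(turanian \<alpha> \<nu> has_real_derivative 0) (at x)"
    using DERIV_turanian[OF x(1), of \<alpha> \<nu>] by (simp only:)
  moreover have "x \<notin> cylinder_zeros \<alpha> (\<nu> + 1)"
  proof
    assume "x \<in> cylinder_zeros \<alpha> (\<nu> + 1)"
    from turanian_strict_min[OF assms this] x(2) have "\<forall>\<^sub>F y in at x. False"
      by eventually_elim simp
    then show False
      by simp
  qed
  ultimately show "x \<in> cylinder_zeros \<alpha> (\<nu> - 1)"
    using critical_points_turanian x(1) by blast
next
  fix x assume x: "x \<in> cylinder_zeros \<alpha> (\<nu> - 1)"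
  then show "x \<in> rel_max_points (turanian \<alpha> \<nu>)"
    using turanian_strict_max[OF assms x]
    by (auto simp: rel_max_points_def cylinder_zeros_def at_within_pos elim: eventually_mono)
qed

lemma rel_min_points_turanian:
  assumes "\<nu> > 0"
  shows "rel_min_points (turanian \<alpha> \<nu>) = cylinder_zeros \<alpha> (\<nu> + 1)"
proof (intro equalityI subsetI)
  fix x assume "x \<in> rel_min_points (turanian \<alpha> \<nu>)"
  then have x: "x > 0" "\<forall>\<^sub>F y in at x. turanian \<alpha> \<nu> x \<le> turanian \<alpha> \<nu> y"
    by (auto simp: rel_min_points_def at_within_pos)
  then have "- (2 / x * (cylinder_C \<alpha> (\<nu> - 1) x * cylinder_C \<alpha> (\<nu> + 1) x)) = 0"
    using DERIV_eventually_max_eq_0[OF DERIV_minus[OF DERIV_turanian[OF x(1), of \<alpha> \<nu>]]] by simp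
  then have "(turanian \<alpha> \<nu> has_real_derivative 0) (at x)"
    using DERIV_turanian[OF x(1), of \<alpha> \<nu>] by (simp only: neg_equal_0_iff_equal)
  moreover have "x \<notin> cylinder_zeros \<alpha> (\<nu> - 1)"
  proof
    assume "x \<in> cylinder_zeros \<alpha> (\<nu> - 1)"
    from turanian_strict_max[OF assms this] x(2) have "\<forall>\<^sub>F y in at x. False"
      by eventually_elim simp
    then show False
      by simp
  qed
  ultimately show "x \<in> cylinder_zeros \<alpha> (\<nu> + 1)"
    using critical_points_turanian x(1) by blast
next
  fix x assume x: "x \<in> cylinder_zeros \<alpha> (\<nu> + 1)"
  then show "x \<in> rel_min_points (turanian \<alpha> \<nu>)"
    using turanian_strict_min[OF assms x]
    by (auto simp: rel_min_points_def cylinder_zeros_def at_within_pos elim: eventually_mono)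
qed

lemma turanian_pos:
  assumes "\<nu> > 0" "c \<in> cylinder_zeros \<alpha> (\<nu> - 1)" "c \<le> x"
  shows "turanian \<alpha> \<nu> x > 0"
proof -
  \<comment> \<open>A zero to the right of \<open>x\<close> closes the interval, so that the
    Turanian is positive at both ends.\<close>
  obtain d where d: "d \<ge> x" "d \<in> cylinder_zeros \<alpha> (\<nu> - 1)"
    using cylinder_has_zero_ge by blast
  have "c > 0"
    using assms(2) by (simp add: cylinder_zeros_def)
  then have "continuous_on {c..d} (turanian \<alpha> \<nu>)"
    by (intro continuous_at_imp_continuous_on ballI DERIV_isCont[OF DERIV_turanian]) auto
  then obtain m where m: "m \<in> {c..d}" "\<And>y. y \<in> {c..d} \<Longrightarrow> turanian \<alpha> \<nu> m \<le> turanian \<alpha> \<nu> y"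
    using continuous_attains_inf[of "{c..d}" "turanian \<alpha> \<nu>"] assms(3) d(1) by auto
  have "m \<in> cylinder_zeros \<alpha> (\<nu> - 1) \<or> m \<in> cylinder_zeros \<alpha> (\<nu> + 1)"
  proof (cases "m = c \<or> m = d")
    case False
    then have "m \<in> {c<..<d}"
      using m(1) by auto
    then have "\<forall>\<^sub>F y in at m. y \<in> {c<..<d}"
      by (intro eventually_at_in_open') auto
    then have "\<forall>\<^sub>F y in at m. turanian \<alpha> \<nu> m \<le> turanian \<alpha> \<nu> y"
      by eventually_elim (simp add: m(2))
    \<comment> \<open>An interior minimizer is a relative minimum, hence a zero at order
      \<open>\<nu> + 1\<close>.\<close>
    then have "m \<in> rel_min_points (turanian \<alpha> \<nu>)"
      using \<open>c > 0\<close> m(1) by (simp add: rel_min_points_def at_within_pos)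
    then show ?thesis
      by (simp add: rel_min_points_turanian[OF assms(1)])
  qed (use assms(2) d(2) in auto)
  then have "turanian \<alpha> \<nu> m > 0"
    by (rule turanian_at_zero)
  also have "turanian \<alpha> \<nu> m \<le> turanian \<alpha> \<nu> x"
    using m(2) assms(3) d(1) by simp
  finally show ?thesis .
qed

theorem theorem3:
  fixes \<alpha> \<nu> :: real
  assumes "0 \<le> \<alpha>" "\<alpha> < pi" "\<nu> > 0"
  shows "rel_max_points (turanian \<alpha> \<nu>) = cylinder_zeros \<alpha> (\<nu> - 1)
    \<and> rel_min_points (turanian \<alpha> \<nu>) = cylinder_zeros \<alpha> (\<nu> + 1)
    \<and> (\<forall>k\<ge>1. rel_max_value (turanian \<alpha> \<nu>) k = turanian \<alpha> \<nu> (cylinder_zero \<alpha> (\<nu> - 1) k)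
         \<and> turanian \<alpha> \<nu> (cylinder_zero \<alpha> (\<nu> - 1) k)
             = (cylinder_C \<alpha> \<nu> (cylinder_zero \<alpha> (\<nu> - 1) k))\<^sup>2
         \<and> (cylinder_C \<alpha> \<nu> (cylinder_zero \<alpha> (\<nu> - 1) k))\<^sup>2 > 0)
    \<and> (\<forall>k\<ge>1. rel_min_value (turanian \<alpha> \<nu>) k = turanian \<alpha> \<nu> (cylinder_zero \<alpha> (\<nu> + 1) k)
         \<and> turanian \<alpha> \<nu> (cylinder_zero \<alpha> (\<nu> + 1) k)
             = (cylinder_C \<alpha> \<nu> (cylinder_zero \<alpha> (\<nu> + 1) k))\<^sup>2
         \<and> (cylinder_C \<alpha> \<nu> (cylinder_zero \<alpha> (\<nu> + 1) k))\<^sup>2 > 0)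
    \<and> (\<forall>x\<ge>cylinder_zero \<alpha> (\<nu> - 1) 1.
         (cylinder_C \<alpha> \<nu> x)\<^sup>2 - cylinder_C \<alpha> (\<nu> - 1) x * cylinder_C \<alpha> (\<nu> + 1) x > 0)"
proof -
  note points = rel_max_points_turanian[OF assms(3), of \<alpha>] rel_min_points_turanian[OF assms(3), of \<alpha>]
  \<comment> \<open>Extremal values are indexed through the sets of extremal points, so equality of
    these sets with the zero sets matches them for each \<open>k\<close>.\<close>
  have max: "rel_max_value (turanian \<alpha> \<nu>) k = turanian \<alpha> \<nu> (cylinder_zero \<alpha> (\<nu> - 1) k)"
    and min: "rel_min_value (turanian \<alpha> \<nu>) k = turanian \<alpha> \<nu> (cylinder_zero \<alpha> (\<nu> + 1) k)" for k
    by (simp_all only: rel_max_value_def rel_min_value_def cylinder_zero_def points)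
  have zeros: "cylinder_zero \<alpha> (\<nu> - 1) k \<in> cylinder_zeros \<alpha> (\<nu> - 1)"
    "cylinder_zero \<alpha> (\<nu> + 1) k \<in> cylinder_zeros \<alpha> (\<nu> + 1)" if "k \<ge> 1" for k
    using that by (simp_all only: cylinder_zero_mem)
  have "turanian \<alpha> \<nu> x > 0" if "x \<ge> cylinder_zero \<alpha> (\<nu> - 1) 1" for x
    by (rule turanian_pos[OF assms(3) zeros(1)[OF order_refl] that])
  moreover have "turanian \<alpha> \<nu> x = (cylinder_C \<alpha> \<nu> x)\<^sup>2 \<and> (cylinder_C \<alpha> \<nu> x)\<^sup>2 > 0"
    if "x \<in> cylinder_zeros \<alpha> (\<nu> - 1) \<or> x \<in> cylinder_zeros \<alpha> (\<nu> + 1)" for x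
    using turanian_at_zero[OF that] by simp
  ultimately show ?thesis
    using points max min zeros unfolding turanian_def[of \<alpha> \<nu>, symmetric] by blast
qed

end
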